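(* Let $m\ge1$, $\Gamma\le S_m$ arbitrary. Take $\pi$ uniform in $\Gamma^n\rtimes S_n$, let $C_1,C_2,\dots$ be its cycle lengths and $C=\left(\frac{C_1}{mn},\frac{C_2}{mn},\dots\right)$. Then $$d_{L^\infty}(C,\mathcal A)\le \frac1n,\qquad d_{L^1}(C,\mathcal A)\le\frac{3(\log n+\gamma)}{n}+O(1/n^2),$$ where $\mathcal A$ is the random partition defined in the context (the solution of $\mathcal A\overset d=(U\mathcal B,(1-U)\mathcal A)$).
   Context: Partitions of unity are nonnegative sequences summing to $1$, identified with their nonincreasing rearrangements (padded with zeros); $d_\rho(X,Y)=\inf\mathbb E\rho(X,Y)$ over couplings, with $\rho$ the $\ell^\infty$ or $\ell^1$ distance of sorted sequences. $\Gamma^n\rtimes S_n$ consists of permutations $(g_1,\dots,g_n;h)$, $g_i\in\Gamma$, $h\in S_n$, of $\{1,\dots,mn\}$ acting by $(i-1)m+r\mapsto(h(i)-1)m+g_i(r)$. $\mathcal B=\left(\frac{D_1}{m},\frac{D_2}{m},\dots\right)$ where $D_1,D_2,\dots$ are the cycle lengths of a uniform element of $\Gamma$. Let $U_1,U_2,\dots$ be iid uniform on $[0,1]$, $V_i=U_i\prod_{r<i}(1-U_r)$, and $\mathcal B^{(1)},\mathcal B^{(2)},\dots$ iid copies of $\mathcal B$ independent of the $U$'s; $\mathcal A$ is the partition with parts $V_i\,\mathcal B^{(i)}_j$, $i,j\ge1$. It satisfies $\mathcal A\overset d=(U\mathcal B,(1-U)\mathcal A)$ with $U$ uniform and $U,\mathcal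 B,\mathcal A$ independent on the right. $\gamma$ is the Euler–Mascheroni constant. *)

theory Defs
  imports "HOL-Probability.Probability" "HOL-Algebra.Sym_Groups" "HOL-Combinatorics.Orbits"
begin

text \<open>Nonincreasing rearrangement (padded with zeros) of a nonnegative family of
  reals indexed by an arbitrary type: the k-th largest entry (k counted from 0).\<close>
definition desc_rearr :: "('a \<Rightarrow> real) \<Rightarrow> nat \<Rightarrow> real" where
  "desc_rearr x k = Inf {t. 0 \<le> t \<and> finite {i. t < x i} \<and> card {i. t < x i} \<le> k}"

definition seqM :: "(nat \<Rightarrow> real) measure" where
  "seqM = PiM UNIV (\<lambda>_. borel)"

definition rho_inf :: "(nat \<Rightarrow> real) \<Rightarrow> (nat \<Rightarrow> real) \<Rightarrow> ennreal" where
  "rho_inf x y = (SUP k. ennreal \<bar>x k - y k\<bar>)"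

definition rho_1 :: "(nat \<Rightarrow> real) \<Rightarrow> (nat \<Rightarrow> real) \<Rightarrow> ennreal" where
  "rho_1 x y = (\<Sum>k. ennreal \<bar>x k - y k\<bar>)"

definition couplings :: "(nat \<Rightarrow> real) measure \<Rightarrow> (nat \<Rightarrow> real) measure
    \<Rightarrow> ((nat \<Rightarrow> real) \<times> (nat \<Rightarrow> real)) measure set" where
  "couplings \<mu> \<nu> = {M. prob_space M \<and> sets M = sets (seqM \<Otimes>\<^sub>M seqM) \<and>
      distr M seqM fst = \<mu> \<and> distr M seqM snd = \<nu>}"

definition dist_rho :: "((nat \<Rightarrow> real) \<Rightarrow> (nat \<Rightarrow> real) \<Rightarrow> ennreal)
    \<Rightarrow> (nat \<Rightarrow> real) measure \<Rightarrow> (nat \<Rightarrow> real) measure \<Rightarrow> ennreal" where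
  "dist_rho \<rho> \<mu> \<nu> = (INF M \<in> couplings \<mu> \<nu>. \<integral>\<^sup>+ z. \<rho> (fst z) (snd z) \<partial>M)"

definition cycle_partition :: "nat \<Rightarrow> (nat \<Rightarrow> nat) \<Rightarrow> nat \<Rightarrow> real" where
  "cycle_partition N \<sigma> = desc_rearr
     (\<lambda>Z. if Z \<in> {orbit \<sigma> x | x. x \<in> {1..N}} then real (card Z) / real N else 0)"

text \<open>Action of (g_1,...,g_n; h) in Gamma^n \<rtimes> S_n on {1..m n}:
  (i-1)m + r \<mapsto> (h(i)-1)m + g_i(r).\<close>
definition wreath_act :: "nat \<Rightarrow> nat \<Rightarrow> (nat \<Rightarrow> nat \<Rightarrow> nat) \<Rightarrow> (nat \<Rightarrow> nat) \<Rightarrow> nat \<Rightarrow> nat" where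
  "wreath_act m n g h x =
     (if x \<in> {1..m*n} then
        (let i = (x - 1) div m + 1; r = (x - 1) mod m + 1 in (h i - 1) * m + g i r)
      else x)"

definition lawC :: "nat \<Rightarrow> (nat \<Rightarrow> nat) set \<Rightarrow> nat \<Rightarrow> (nat \<Rightarrow> real) measure" where
  "lawC m \<Gamma> n = distr
     (measure_pmf (map_pmf (\<lambda>(g, h). cycle_partition (m*n) (wreath_act m n g h))
        (pmf_of_set ((PiE {1..n} (\<lambda>_. \<Gamma>)) \<times> {h. h permutes {1..n}}))))
     seqM (\<lambda>x. x)"

definition lawB :: "nat \<Rightarrow> (nat \<Rightarrow> nat) set \<Rightarrow> (nat \<Rightarrow> real) measure" where
  "lawB m \<Gamma> = distr (measure_pmf (map_pmf (cycle_partition m) (pmf_of_set \<Gamma>))) seqM (\<lambda>x. x)"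

definition stick :: "(nat \<Rightarrow> real) \<Rightarrow> nat \<Rightarrow> real" where
  "stick U i = U i * (\<Prod>r<i. 1 - U r)"

definition lawA :: "nat \<Rightarrow> (nat \<Rightarrow> nat) set \<Rightarrow> (nat \<Rightarrow> real) measure" where
  "lawA m \<Gamma> = distr
     ((PiM UNIV (\<lambda>_. uniform_measure lborel {0..1::real})) \<Otimes>\<^sub>M (PiM UNIV (\<lambda>_. lawB m \<Gamma>)))
     seqM
     (\<lambda>(U, B). desc_rearr (\<lambda>(i, j). stick U i * B i j))"

end

theory Submission
  imports Defs
begin

text \<open>
  Write \<open>T\<^sub>i\<close> for the length left after \<open>i\<close> steps of the stick breaking, so that the \<open>i\<close>-th stick of
  \<open>\<A>\<close> is \<open>T\<^sub>i - T\<^bsub>i+1\<^esub>\<close>. The coupling rounds the break points to the grid of mesh \<open>1/n\<close>: replace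
  the stick by \<open>(\<lfloor>n T\<^sub>i\<rfloor> - \<lfloor>n T\<^bsub>i+1\<^esub>\<rfloor>)/n\<close> and keep \<open>\<B>\<^bsup>(i)\<^esup>\<close>. Zero lengths are harmless, and the
  distinct values of \<open>\<lfloor>n T\<^sub>i\<rfloor>\<close> form the chain that jumps from \<open>r\<close> to a uniform element of
  \<open>{0,\<dots>,r-1}\<close>, because a uniform point of \<open>[0,s]\<close> conditioned to leave the cell \<open>[\<lfloor>s\<rfloor>,\<lfloor>s\<rfloor>+1)\<close> has a
  uniform integer part. This is also the law of the numbers of points of a uniform permutation
  left after successive removal of cycles, and the cycle products of an element of the wreath product are
  independent and uniform, so the rounded partition has the law of \<open>C\<close>.

  Each stick moves by the difference of two fractional parts over \<open>n\<close>, hence by less than \<open>1/n\<close>, which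
  gives the \<open>L\<^sup>\<infinity>\<close> bound because sorting is a contraction. The total variation of the fractional parts has
  mean at most twice the harmonic number of \<open>n\<close>, which gives the \<open>L\<^sup>1\<close> bound.
\<close>

section \<open>Nonincreasing rearrangement\<close>

text \<open>The two laws are compared without building either chain as a process. A set of sequences
  is tested by its indicator, and the mean of the test obeys a one-step recursion:
  \<open>bval\<close> for permutations, \<open>val\<close> for sticks, each with an accumulator for
  the parts already found. On the permutation side, removing a whole cycle at once would require a
  description of what is left; instead one block at a time is merged into a marked block that
  remembers how many it has absorbed. On the stick side the obstacle is that one break takes the
  length off the grid, so \<open>val\<close> must be studied for every real length and shown to
  depend on its integer part only. A break that stays in its cell produces no part and leads back to
  the same unknown, so induction on the integer part does not close by itself; a contraction inside
  the cell does the rest. The variation argument yields \<open>2 * harm n / n\<close>; the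
  coefficient 2 leaves room below the claimed 3, and \<open>K = 2\<close> comes from comparing the
  harmonic number with \<open>ln n + euler_mascheroni\<close>.\<close>

text \<open>Families are represented by the function counting the entries above each level: disjoint
  union becomes addition, and the order of the entries is forgotten.\<close>

definition lcount :: "('a \<Rightarrow> real) \<Rightarrow> real \<Rightarrow> ennreal" where
  "lcount x t = emeasure (count_space UNIV) {i. t < x i}"

text \<open>It accepts any level function, so that counts coming from different index types, such as
  parts of a family and orbits of a permutation, can be added and then rearranged.\<close>

definition rearr :: "(real \<Rightarrow> ennreal) \<Rightarrow> nat \<Rightarrow> real" where
  "rearr c k = Inf {t. 0 \<le> t \<and> c t \<le> of_nat k}"

lemma lcount_le_iff: "lcount x t \<le> of_nat k \<longleftrightarrow> finite {i. t < x i} \<and> card {i. t < x i} \<le> k"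
proof (cases "finite {i. t < x i}")
  case True
  then show ?thesis by (simp add: lcount_def)
next
  case False
  then show ?thesis using of_nat_less_top[of k] by (simp add: lcount_def top_unique)
qed

lemma desc_rearr_eq_rearr: "desc_rearr x = rearr (lcount x)"
  by (simp add: fun_eq_iff desc_rearr_def rearr_def lcount_le_iff)

text \<open>Negative levels are never consulted. Hence zero entries are invisible, and families over
  different index types may be exchanged.\<close>

lemma rearr_cong:
  assumes "\<And>t. 0 \<le> t \<Longrightarrow> c t = c' t"
  shows "rearr c = rearr c'"
  by (auto simp: rearr_def fun_eq_iff assms intro!: arg_cong[where f=Inf])

lemma antimono_lcount: "antimono (lcount x)"
  by (auto simp: antimono_def lcount_def intro!: emeasure_mono)

lemma lcount_bounded_eq_0:
  assumes "\<And>i. x i \<le> b"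
  shows "lcount x b = 0"
proof -
  have "{i. b < x i} = {}" using assms by (auto simp: not_less)
  then show ?thesis by (simp add: lcount_def)
qed

text \<open>The Galois connection between levels and ranks. Strictness survives the infimum because
  \<open>k + 1\<close> entries above \<open>t\<close> have a minimum, which is still above
  \<open>t\<close> and bounds every admissible level from below. The bound \<open>b\<close> keeps
  the set of admissible levels nonempty.\<close>

lemma less_rearr_iff:
  assumes t: "0 \<le> t" and b: "\<And>i. x i \<le> b"
  shows "t < desc_rearr x k \<longleftrightarrow> of_nat k < lcount x t"
proof -
  define E where "E = {t. 0 \<le> t \<and> lcount x t \<le> of_nat k}"
  have bdd: "bdd_below E" by (auto simp: E_def intro!: bdd_belowI[of _ 0])
  have "max 0 b \<in> E"
    using lcount_bounded_eq_0[of x "max 0 b"] b by (simp add: E_def le_max_iff_disj)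
  then have ne: "E \<noteq> {}" by auto
  have desc: "desc_rearr x k = Inf E" by (simp add: desc_rearr_eq_rearr rearr_def E_def)
  show ?thesis
  proof
    assume "t < desc_rearr x k"
    then have "t \<notin> E" using cInf_lower[OF _ bdd] unfolding desc by force
    then show "of_nat k < lcount x t" using t by (auto simp: E_def not_le)
  next
    assume k: "of_nat k < lcount x t"
    have "\<exists>S. finite S \<and> card S = Suc k \<and> S \<subseteq> {i. t < x i}"
    proof (cases "finite {i. t < x i}")
      case True
      then have "Suc k \<le> card {i. t < x i}" using k by (simp add: lcount_def)
      then show ?thesis by (meson True finite_subset obtain_subset_with_card_n)
    next
      case False
      then show ?thesis by (meson infinite_arbitrarily_large)
    qed
    then obtain S where S: "finite S" "card S = Suc k" "S \<subseteq> {i. t < x i}" by blast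
    then have Sne: "S \<noteq> {}" by auto
    have "Min (x ` S) \<le> e" if "e \<in> E" for e
    proof (rule ccontr)
      assume "\<not> ?thesis"
      then have "S \<subseteq> {i. e < x i}" using S(1) Sne by (auto simp: not_le)
      moreover have "finite {i. e < x i}" "card {i. e < x i} \<le> k"
        using that by (auto simp: E_def lcount_le_iff)
      ultimately show False using S(2) by (metis Suc_n_not_le_n card_mono order.trans)
    qed
    then have "Min (x ` S) \<le> Inf E" by (intro cInf_greatest ne) auto
    moreover have "t < Min (x ` S)" using S Sne by auto
    ultimately show "t < desc_rearr x k" unfolding desc by linarith
  qed
qed

lemma desc_rearr_nonneg:
  assumes "\<And>i. x i \<le> b"
  shows "0 \<le> desc_rearr x k"
proof -
  have "max 0 b \<in> {t. 0 \<le> t \<and> lcount x t \<le> of_nat k}"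
    using lcount_bounded_eq_0[of x "max 0 b"] assms by (simp add: le_max_iff_disj)
  then show ?thesis
    unfolding desc_rearr_eq_rearr rearr_def by (intro cInf_greatest) blast+
qed

text \<open>By \<open>less_rearr_iff\<close> the ranks whose entry exceeds \<open>t\<close> form an
  initial segment of the naturals of length \<open>lcount x t\<close>, possibly all of them.\<close>

lemma lcount_desc_rearr:
  assumes t: "0 \<le> t" and b: "\<And>i. x i \<le> b"
  shows "lcount (desc_rearr x) t = lcount x t"
proof -
  have *: "{k. t < desc_rearr x k} = {k. of_nat k < lcount x t}"
    using less_rearr_iff[where x=x, OF t b] by auto
  show ?thesis
  proof (cases "finite {i. t < x i}")
    case True
    then have "{k. t < desc_rearr x k} = {..<card {i. t < x i}}"
      unfolding * by (auto simp: lcount_def)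
    then show ?thesis using True by (simp add: lcount_def)
  next
    case False
    then have "{k. t < desc_rearr x k} = UNIV"
      unfolding * by (auto simp: lcount_def of_nat_less_top)
    then show ?thesis using False by (simp add: lcount_def)
  qed
qed

text \<open>Otherwise more than \<open>k\<close> entries of \<open>x\<close> lie above
  \<open>desc_rearr y k + e\<close>. The entries of \<open>y\<close> at these indices lie above
  \<open>desc_rearr y k\<close>, which is too many for rank \<open>k\<close>.\<close>

lemma desc_rearr_le_shift:
  assumes "\<And>i. x i \<le> y i + e" "\<And>i. y i \<le> b" "0 \<le> e"
  shows "desc_rearr x k \<le> desc_rearr y k + e"
proof (rule ccontr)
  assume "\<not> ?thesis"
  then have l: "desc_rearr y k + e < desc_rearr x k" by simp
  have nn: "0 \<le> desc_rearr y k" by (rule desc_rearr_nonneg[OF assms(2)])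
  have xb: "x i \<le> b + e" for i using assms(1,2)[of i] by linarith
  have "of_nat k < lcount x (desc_rearr y k + e)"
    using less_rearr_iff[of "desc_rearr y k + e" x "b + e" k] xb l nn assms(3) by simp
  also have "lcount x (desc_rearr y k + e) \<le> lcount y (desc_rearr y k)"
    unfolding lcount_def 
  proof (intro emeasure_mono subsetI)
    fix i assume "i \<in> {i. desc_rearr y k + e < x i}"
    then show "i \<in> {i. desc_rearr y k < y i}" using assms(1)[of i] by simp
  qed simp
  finally show False using less_rearr_iff[where x=y and k=k, OF nn assms(2)] by simp
qed

lemma desc_rearr_dist_sup:
  assumes "\<And>i. \<bar>x i - y i\<bar> \<le> e" "\<And>i. x i \<le> b" "\<And>i. y i \<le> b" "0 \<le> e"
  shows "\<bar>desc_rearr x k - desc_rearr y k\<bar> \<le> e"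
proof -
  have "x i \<le> y i + e" "y i \<le> x i + e" for i using assms(1)[of i] by linarith+
  then show ?thesis
    using desc_rearr_le_shift[of x y e b k] desc_rearr_le_shift[of y x e b k] assms(2-4)
    by (simp add: abs_le_iff)
qed

lemma desc_rearr_zero: "desc_rearr (\<lambda>_. 0) k = 0"
  unfolding desc_rearr_def by (intro cInf_eq_minimum) auto

text \<open>The cut to nonnegative levels matches \<open>less_rearr_iff\<close>, which holds only
  there.\<close>

lemma nn_integral_abs_indicator_less:
  fixes a b :: real
  assumes "0 \<le> a" "0 \<le> b"
  shows "(\<integral>\<^sup>+t. indicator {0..} t * of_bool ((t < a) \<noteq> (t < b)) \<partial>lborel) = ennreal \<bar>a - b\<bar>"
proof -
  have "(\<integral>\<^sup>+t. indicator {0..} t * of_bool ((t < a) \<noteq> (t < b)) \<partial>lborel) =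
      (\<integral>\<^sup>+t. indicator {min a b..<max a b} t \<partial>lborel)"
    using assms by (intro nn_integral_cong) (auto simp: indicator_def)
  also have "\<dots> = ennreal \<bar>a - b\<bar>"
    by (simp add: abs_real_def max_def min_def)
  finally show ?thesis .
qed

lemma nn_integral_of_bool:
  "(\<integral>\<^sup>+k. of_bool (P k) \<partial>count_space UNIV) = emeasure (count_space UNIV) {k. P k}"
proof -
  have "(\<lambda>k. of_bool (P k)) = (indicator {k. P k} :: _ \<Rightarrow> ennreal)"
    by (simp add: fun_eq_iff indicator_def)
  then show ?thesis by (simp add: nn_integral_indicator)
qed

text \<open>For finite level sets the left side is the difference of their sizes and the right side
  the size of their symmetric difference. Two infinite level sets agree at every rank, and if just
  one is infinite, so is the symmetric difference.\<close>

lemma levels_neq_le_count: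
  fixes x y :: "'a \<Rightarrow> real"
  shows "(\<integral>\<^sup>+k. of_bool ((of_nat (k::nat) < lcount x t) \<noteq> (of_nat k < lcount y t)) \<partial>count_space UNIV)
    \<le> (\<integral>\<^sup>+i. of_bool ((t < x i) \<noteq> (t < y i)) \<partial>count_space UNIV)"
proof -
  define X where "X = {i. t < x i}"
  define Y where "Y = {i. t < y i}"
  have L: "(\<integral>\<^sup>+k. of_bool ((of_nat (k::nat) < lcount x t) \<noteq> (of_nat k < lcount y t)) \<partial>count_space UNIV)
     = emeasure (count_space UNIV) {k::nat. (of_nat k < lcount x t) \<noteq> (of_nat k < lcount y t)}"
    by (rule nn_integral_of_bool)
  have R: "(\<integral>\<^sup>+i. of_bool ((t < x i) \<noteq> (t < y i)) \<partial>count_space UNIV)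
     = emeasure (count_space UNIV) ((X - Y) \<union> (Y - X))"
    by (subst nn_integral_of_bool) (auto simp: X_def Y_def intro!: arg_cong[where f="emeasure _"])
  show ?thesis
  proof (cases "finite ((X - Y) \<union> (Y - X))")
    case False
    then show ?thesis unfolding L R by (simp del: finite_Un)
  next
    case fin: True
    then have f: "finite (X - Y)" "finite (Y - X)" by auto
    show ?thesis
    proof (cases "finite X")
      case X: True
      have Y: "finite Y" using f X
        by (metis Diff_infinite_finite)
      have "{k::nat. (of_nat k < lcount x t) \<noteq> (of_nat k < lcount y t)}
          = {min (card X) (card Y)..<max (card X) (card Y)}"
        using X Y by (auto simp: lcount_def X_def[symmetric] Y_def[symmetric])
      then have *: "emeasure (count_space UNIV) {k::nat. (of_nat k < lcount x t) \<noteq> (of_nat k < lcount y t)}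
         = of_nat (max (card X) (card Y) - min (card X) (card Y))"
        by simp
      have "card X \<le> card Y + card (X - Y)" "card Y \<le> card X + card (Y - X)"
        by (metis X Y card_Un_le Un_Diff_cancel Un_upper2 card_mono finite_Un order.trans)+
      moreover have "card ((X - Y) \<union> (Y - X)) = card (X - Y) + card (Y - X)"
        using f by (intro card_Un_disjoint) auto
      ultimately have "max (card X) (card Y) - min (card X) (card Y) \<le> card ((X - Y) \<union> (Y - X))"
        by linarith
      then show ?thesis unfolding L R * using fin
        by (simp add:)
    next
      case X: False
      then have Y: "infinite Y" using f by (metis Diff_infinite_finite)
      have "lcount x t = \<infinity>" "lcount y t = \<infinity>"
        using X Y by (simp_all add: lcount_def X_def Y_def)
      then show ?thesis by simp
    qed
  qed
qed

text \<open>Layer-cake: the distance is the integral over levels \<open>t\<close> of the number of indices at which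
  exactly one of the two families exceeds \<open>t\<close>, and rearranging can only decrease that number.\<close>

lemma desc_rearr_dist_sum:
  fixes x y :: "'a::countable \<Rightarrow> real"
  assumes x: "\<And>i. 0 \<le> x i" "\<And>i. x i \<le> b" and y: "\<And>i. 0 \<le> y i" "\<And>i. y i \<le> b"
  shows "rho_1 (desc_rearr x) (desc_rearr y) \<le> (\<integral>\<^sup>+i. ennreal \<bar>x i - y i\<bar> \<partial>count_space UNIV)"
proof -
  interpret C: sigma_finite_measure "count_space (UNIV :: 'a set)"
    by (rule sigma_finite_measure_count_space)
  interpret N: sigma_finite_measure "count_space (UNIV :: nat set)"
    by (rule sigma_finite_measure_count_space)
  interpret P: pair_sigma_finite "count_space (UNIV :: 'a set)" lborel ..
  interpret PN: pair_sigma_finite "count_space (UNIV :: nat set)" lborel ..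
  let ?f = "\<lambda>a b t. indicator {0..} t * of_bool ((t < a) \<noteq> (t < b)) :: ennreal"
  have m1: "(\<lambda>(i, t). ?f (x i) (y i) t) \<in> borel_measurable (count_space UNIV \<Otimes>\<^sub>M lborel)"
    by (rule measurable_pair_measure_countable1) auto
  have m2: "(\<lambda>(k, t). ?f (desc_rearr x k) (desc_rearr y k) t) \<in> borel_measurable (count_space UNIV \<Otimes>\<^sub>M lborel)"
    by (rule measurable_pair_measure_countable1) auto
  have "rho_1 (desc_rearr x) (desc_rearr y) =
      (\<integral>\<^sup>+k. (\<integral>\<^sup>+t. ?f (desc_rearr x k) (desc_rearr y k) t \<partial>lborel) \<partial>count_space UNIV)"
    unfolding rho_1_def
    by (subst nn_integral_abs_indicator_less)
       (auto simp: nn_integral_count_space_nat intro!: desc_rearr_nonneg x y)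
  also have "\<dots> = (\<integral>\<^sup>+t. (\<integral>\<^sup>+k. ?f (desc_rearr x k) (desc_rearr y k) t \<partial>count_space UNIV) \<partial>lborel)"
    by (rule PN.Fubini'[OF m2, symmetric])
  also have "\<dots> \<le> (\<integral>\<^sup>+t. (\<integral>\<^sup>+i. ?f (x i) (y i) t \<partial>count_space UNIV) \<partial>lborel)"
  proof (rule nn_integral_mono)
    fix t :: real
    show "(\<integral>\<^sup>+k. ?f (desc_rearr x k) (desc_rearr y k) t \<partial>count_space UNIV) \<le>
        (\<integral>\<^sup>+i. ?f (x i) (y i) t \<partial>count_space UNIV)"
      using levels_neq_le_count[of x t y]
      by (cases "0 \<le> t") (simp_all add: less_rearr_iff[OF _ x(2)] less_rearr_iff[OF _ y(2)])
  qed
  also have "\<dots> = (\<integral>\<^sup>+i. (\<integral>\<^sup>+t. ?f (x i) (y i) t \<partial>lborel) \<partial>count_space UNIV)"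
    by (rule P.Fubini'[OF m1])
  also have "\<dots> = (\<integral>\<^sup>+i. ennreal \<bar>x i - y i\<bar> \<partial>count_space UNIV)"
    by (intro nn_integral_cong nn_integral_abs_indicator_less x y)
  finally show ?thesis .
qed

text \<open>Since level functions decrease, the admissible levels form an up-set, and whether its
  infimum lies below \<open>a\<close> can be decided at the countably many rational levels.\<close>

lemma measurable_rearr:
  assumes [measurable]: "\<And>t. (\<lambda>w. C w t) \<in> borel_measurable M"
    and anti: "\<And>w. w \<in> space M \<Longrightarrow> antimono (C w)"
  shows "(\<lambda>w. rearr (C w)) \<in> measurable M seqM"
  unfolding seqM_def
proof (rule measurable_PiM_single')
  show "(\<lambda>w i. rearr (C w) i) \<in> space M \<rightarrow> (\<Pi>\<^sub>E i\<in>UNIV. space borel)" by auto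
  fix k :: nat
  show "(\<lambda>w. rearr (C w) k) \<in> borel_measurable M"
  proof (rule borel_measurable_iff_less[THEN iffD2], safe)
    fix a :: real
    \<comment> \<open>The second branch is the case without admissible levels, where the entry is
      the fixed value \<open>Inf {}\<close>.\<close>
    have *: "rearr (C w) k < a \<longleftrightarrow>
      (if \<exists>q::rat. 0 \<le> q \<and> C w (of_rat q) \<le> of_nat k
        then \<exists>q::rat. 0 \<le> q \<and> of_rat q < a \<and> C w (of_rat q) \<le> of_nat k else Inf {} < a)"
      (is "_ \<longleftrightarrow> (if ?ne then ?ex else _)") if w: "w \<in> space M" for w
    proof -
      define E where "E = {t. 0 \<le> t \<and> C w t \<le> of_nat k}"
      have up: "t' \<in> E" if "t \<in> E" "t \<le> t'" for t t'
        using anti[OF w] that unfolding E_def antimono_def by (auto intro: order.trans)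
      have rat: "\<exists>q::rat. 0 \<le> q \<and> of_rat q < d \<and> of_rat q \<in> E" if te: "t \<in> E" and td: "t < d" for t d
      proof -
        obtain q :: rat where "t < of_rat q" "of_rat q < d" using of_rat_dense[OF td] by blast
        moreover have "0 < (of_rat q :: real)" using te \<open>t < of_rat q\<close> unfolding E_def by (blast intro: le_less_trans)
        then have "0 \<le> q" by (simp only: zero_less_of_rat_iff less_imp_le)
        ultimately show ?thesis using up[OF te, of "of_rat q"] by auto
      qed
      have "?ne \<longleftrightarrow> E \<noteq> {}"
      proof
        assume "E \<noteq> {}"
        then obtain t where "t \<in> E" by blast
        then show ?ne using rat[of t "t + 1"] by (auto simp: E_def)
      next
        assume ?ne
        then obtain q :: rat where "0 \<le> q" "C w (of_rat q) \<le> of_nat k" by blast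
        then have "of_rat q \<in> E" by (simp add: E_def)
        then show "E \<noteq> {}" by blast
      qed
      moreover have "Inf E < a \<longleftrightarrow> ?ex" if ne: "E \<noteq> {}"
      proof -
        have "Inf E < a \<longleftrightarrow> (\<exists>t\<in>E. t < a)"
          by (intro cInf_less_iff ne bdd_belowI[of _ 0]) (auto simp: E_def)
        also have "\<dots> \<longleftrightarrow> (\<exists>q::rat. 0 \<le> q \<and> of_rat q < a \<and> of_rat q \<in> E)"
          using rat by blast
        also have "\<dots> \<longleftrightarrow> ?ex" by (auto simp: E_def)
        finally show ?thesis .
      qed
      moreover have "rearr (C w) k = Inf E" by (simp add: rearr_def E_def)
      ultimately show ?thesis by (cases "E = {}") (simp_all only: if_True if_False not_True_eq_False not_False_eq_True simp_thms)
    qed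
    show "{w \<in> space M. rearr (C w) k < a} \<in> sets M"
      by (simp add: * cong: conj_cong) measurable
  qed
qed

section \<open>Cycles of wreath product elements\<close>

text \<open>Weights let one point stand for several contracted ones. With constant weight
  \<open>1 / N\<close> the weight of an orbit is its normalised length.\<close>

definition ocount :: "('a \<Rightarrow> 'a) \<Rightarrow> 'a set \<Rightarrow> ('a \<Rightarrow> real) \<Rightarrow> real \<Rightarrow> ennreal" where
  "ocount f X w t = of_nat (card {Z \<in> orbit f ` X. t < sum w Z})"

lemma orbit_subset_closed:
  assumes "f \<in> X \<rightarrow> X" "x \<in> X"
  shows "orbit f x \<subseteq> X"
proof
  fix y assume "y \<in> orbit f x"
  then show "y \<in> X" by induct (use assms in auto)
qed

lemma ocount_Un:
  assumes "f \<in> X \<rightarrow> X" "f \<in> Y \<rightarrow> Y" "X \<inter> Y = {}" "finite X" "finite Y"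
  shows "ocount f (X \<union> Y) w t = ocount f X w t + ocount f Y w t"
proof -
  have "orbit f ` X \<inter> orbit f ` Y = {}"
  proof (rule ccontr)
    assume "\<not> ?thesis"
    then obtain x y where "x \<in> X" "y \<in> Y" "orbit f x = orbit f y" by (auto simp: disjoint_iff)
    then have "orbit f x \<subseteq> X \<inter> Y"
      using orbit_subset_closed[OF assms(1)] orbit_subset_closed[OF assms(2)] by blast
    then show False using assms(3) orbit_nonempty[of f x] by blast
  qed
  then have "card ({Z \<in> orbit f ` X. t < sum w Z} \<union> {Z \<in> orbit f ` Y. t < sum w Z}) =
      card {Z \<in> orbit f ` X. t < sum w Z} + card {Z \<in> orbit f ` Y. t < sum w Z}"
    using assms(4,5) by (intro card_Un_disjoint) auto
  moreover have "{Z \<in> orbit f ` (X \<union> Y). t < sum w Z} =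
      {Z \<in> orbit f ` X. t < sum w Z} \<union> {Z \<in> orbit f ` Y. t < sum w Z}"
    by (auto simp: image_Un)
  ultimately show ?thesis by (simp add: ocount_def)
qed

text \<open>A conjugacy carries orbits to orbits, and injectivity keeps them distinct. It serves to
  drop the label of a fixed block and to pass from pairs (block, position) to
  \<open>{1..m * n}\<close>.\<close>

lemma ocount_transport:
  assumes inj: "inj_on \<phi> X" and f: "f \<in> X \<rightarrow> X"
    and comm: "\<And>x. x \<in> X \<Longrightarrow> g (\<phi> x) = \<phi> (f x)" and w: "\<And>x. x \<in> X \<Longrightarrow> w' (\<phi> x) = w x"
  shows "ocount g (\<phi> ` X) w' t = ocount f X w t"
proof -
  have orb: "orbit g (\<phi> x) = \<phi> ` orbit f x" if x: "x \<in> X" for x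
  proof (intro equalityI subsetI)
    fix y assume "y \<in> orbit g (\<phi> x)"
    then show "y \<in> \<phi> ` orbit f x"
    proof induct
      case base
      then show ?case using comm[OF x] by (auto intro: orbit.base)
    next
      case (step y)
      then obtain z where "z \<in> orbit f x" "y = \<phi> z" by blast
      then show ?case using comm[of z] orbit_subset_closed[OF f x] by (auto intro: orbit.step)
    qed
  next
    fix y assume "y \<in> \<phi> ` orbit f x"
    then obtain z where "z \<in> orbit f x" "y = \<phi> z" by blast
    then have "\<phi> z \<in> orbit g (\<phi> x)"
    proof (induct arbitrary: y)
      case base
      then show ?case using comm[OF x] orbit.base[of g "\<phi> x"] by simp
    next
      case (step z)
      then show ?case using comm[of z] orbit_subset_closed[OF f x] orbit.step[of "\<phi> z" g "\<phi> x"] by auto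
    qed
    then show "y \<in> orbit g (\<phi> x)" using \<open>y = \<phi> z\<close> by simp
  qed
  have sub: "Z \<subseteq> X" if "Z \<in> orbit f ` X" for Z using that orbit_subset_closed[OF f] by auto
  have sum: "sum w' (\<phi> ` Z) = sum w Z" if "Z \<in> orbit f ` X" for Z
    using sub[OF that] w by (subst sum.reindex) (auto intro!: sum.cong intro: inj_on_subset[OF inj])
  have "{Z \<in> orbit g ` (\<phi> ` X). t < sum w' Z} = (\<lambda>Z. \<phi> ` Z) ` {Z \<in> orbit f ` X. t < sum w Z}"
    using sum by (auto simp: image_image orb)
  moreover have "inj_on (\<lambda>Z. \<phi> ` Z) {Z \<in> orbit f ` X. t < sum w Z}"
    using sub inj by (intro inj_onI) (simp add: inj_on_image_eq_iff)
  ultimately show ?thesis unfolding ocount_def by (simp add: card_image)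
qed

lemma ocount_cong:
  assumes "f \<in> X \<rightarrow> X" "\<And>x. x \<in> X \<Longrightarrow> g x = f x" "\<And>x. x \<in> X \<Longrightarrow> w' x = w x"
  shows "ocount g X w' t = ocount f X w t"
  using ocount_transport[of "\<lambda>x. x" X f g w' w t] assms by simp

text \<open>\<open>f'\<close> is the first-return map of \<open>f\<close> to \<open>Y\<close>; each deleted point is merged
  into its predecessor, which inherits its weight.\<close>

lemma ocount_first_return:
  assumes f: "f permutes X" and fin: "finite X" and YX: "Y \<subseteq> X"
    and ret: "\<And>x. x \<in> X - Y \<Longrightarrow> f x \<in> Y"
    and f': "\<And>y. y \<in> Y \<Longrightarrow> f' y = (if f y \<in> Y then f y else f (f y))"
    and w': "\<And>y. y \<in> Y \<Longrightarrow> w' y = (if f y \<in> Y then w y else w y + w (f y))"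
  shows "ocount f X w t = ocount f' Y w' t"
proof -
  have perm: "permutation f" using f fin by (auto simp: permutation_permutes)
  have fX: "f x \<in> X" if "x \<in> X" for x using that f by (simp add: permutes_in_image)
  have orb: "orbit f' y = orbit f y \<inter> Y" if y: "y \<in> Y" for y
  proof (intro equalityI subsetI)
    fix z assume "z \<in> orbit f' y"
    then show "z \<in> orbit f y \<inter> Y"
    proof induct
      case base
      then show ?case using f'[OF y] ret[of "f y"] fX[of y] y YX by (auto intro: orbit.intros)
    next
      case (step z)
      then show ?case using f'[of z] ret[of "f z"] fX[of z] YX by (auto intro: orbit.intros)
    qed
  next
    fix z assume "z \<in> orbit f y \<inter> Y"
    then have z: "z \<in> orbit f y" "z \<in> Y" by auto
    \<comment> \<open>The orbit of \<open>f\<close> may pass through deleted points, so the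
      invariant speaks of the successor there, which is back in \<open>Y\<close> by
      \<open>ret\<close>.\<close>
    from z(1) have "z \<in> X \<and> (if z \<in> Y then z \<in> orbit f' y else f z \<in> orbit f' y)"
    proof (induct)
      case base
      then show ?case using f'[OF y] orbit.base[of f' y] y YX fX by auto
    next
      case (step z)
      then show ?case
        using f'[of z] orbit.step[of z f' y] ret[of z] fX[of z] by (auto split: if_splits)
    qed
    then show "z \<in> orbit f' y" using \<open>z \<in> Y\<close> by simp
  qed
  have orbY: "orbit f ` X = orbit f ` Y"
  proof (intro equalityI subsetI)
    fix Z assume "Z \<in> orbit f ` X"
    then obtain x where x: "x \<in> X" "Z = orbit f x" by auto
    show "Z \<in> orbit f ` Y"
    proof (cases "x \<in> Y")
      case False
      then have "f x \<in> Y" using ret x by auto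
      then show ?thesis using permutation_orbit_step[OF perm, of x] x by (auto intro!: image_eqI[of _ _ "f x"])
    qed (use x in auto)
  qed (use YX in auto)
  have sub: "orbit f y \<subseteq> X" if "y \<in> Y" for y
    using permutes_orbit_subset[OF f] that YX by auto
  have sum: "sum w' (Z \<inter> Y) = sum w Z" if "Z \<in> orbit f ` Y" for Z
  proof -
    obtain y where y: "y \<in> Y" "Z = orbit f y" using \<open>Z \<in> orbit f ` Y\<close> by auto
    have ZX: "Z \<subseteq> X" and finZ: "finite Z" using sub[OF y(1)] y fin by (auto intro: finite_subset)
    have inZ: "f z \<in> Z \<longleftrightarrow> z \<in> Z" for z
      unfolding y(2)
    proof
      assume "f z \<in> orbit f y"
      moreover have "z \<in> orbit f (f z)"
        unfolding permutation_orbit_step[OF perm] by (rule permutation_self_in_orbit[OF perm])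
      ultimately show "z \<in> orbit f y" by (rule orbit_trans[rotated])
    qed (rule orbit.step)
    \<comment> \<open>The predecessors of the deleted points of \<open>Z\<close>. As
      \<open>f\<close> maps \<open>P\<close> bijectively onto \<open>Z - Y\<close>, the weight moved
      to \<open>P\<close> is exactly the weight deleted.\<close>
    define P where "P = {z \<in> Z \<inter> Y. f z \<notin> Y}"
    have "f ` P = Z - Y"
    proof (intro equalityI subsetI)
      fix z assume z: "z \<in> Z - Y"
      obtain x where x: "f x = z" using permutes_surj[OF f] by (metis surjD)
      have "x \<in> X" using z ZX permutes_in_image[OF f, of x] x by auto
      moreover have "x \<in> Z" using inZ[of x] x z by simp
      ultimately have "x \<in> P" using ret[of x] x z by (auto simp: P_def)
      then show "z \<in> f ` P" using x by force
    qed (auto simp: P_def inZ)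
    then have "sum w (Z - Y) = (\<Sum>z\<in>P. w (f z))"
      using sum.reindex[OF permutes_inj_on[OF f], of w P] by (simp add: comp_def)
    moreover have "sum w' (Z \<inter> Y) = (\<Sum>z\<in>Z \<inter> Y. w z + (if z \<in> P then w (f z) else 0))"
      by (intro sum.cong) (auto simp: P_def w')
    moreover have "\<dots> = sum w (Z \<inter> Y) + (\<Sum>z\<in>P. w (f z))"
      using finZ by (simp add: sum.distrib sum.If_cases P_def) (intro sum.cong, auto)
    moreover have "sum w Z = sum w (Z \<inter> Y) + sum w (Z - Y)"
      using finZ by (rule sum.Int_Diff)
    ultimately show ?thesis by simp
  qed
  have "orbit f' ` Y = (\<lambda>Z. Z \<inter> Y) ` orbit f ` Y"
    using orb by (auto simp: image_image)
  then have "{Z \<in> orbit f' ` Y. t < sum w' Z} = (\<lambda>Z. Z \<inter> Y) ` {Z \<in> orbit f ` Y. t < sum w Z}"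
    using sum by auto
  moreover have "inj_on (\<lambda>Z. Z \<inter> Y) {Z \<in> orbit f ` Y. t < sum w Z}"
  proof (rule inj_onI)
    fix Z1 Z2
    assume Z: "Z1 \<in> {Z \<in> orbit f ` Y. t < sum w Z}" "Z2 \<in> {Z \<in> orbit f ` Y. t < sum w Z}"
      and eq: "Z1 \<inter> Y = Z2 \<inter> Y"
    then obtain y1 y2 where y: "y1 \<in> Y" "y2 \<in> Y" "Z1 = orbit f y1" "Z2 = orbit f y2" by auto
    then have "y1 \<in> orbit f y2" using eq permutation_self_in_orbit[OF perm, of y1] by auto
    then show "Z1 = Z2"
      unfolding y(3,4) by (rule orbit_cyclic_eq3[OF cyclic_on_orbit'[OF perm]])
  qed
  ultimately show ?thesis unfolding ocount_def orbY by (simp add: card_image)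
qed

text \<open>Sorts the permutations by the image \<open>b\<close> of \<open>a\<close>. Composing with
  the transposition cuts \<open>b\<close> out of its cycle and sends \<open>a\<close> directly to
  the old image of \<open>b\<close>; for \<open>b = a\<close> it is the identity and
  \<open>a\<close> is a fixed point.\<close>

lemma sum_permutes_split:
  fixes F :: "(nat \<Rightarrow> nat) \<Rightarrow> real"
  assumes fin: "finite A" and a: "a \<in> A"
  shows "(\<Sum>h | h permutes A. F h) = (\<Sum>b\<in>A. \<Sum>h | h permutes (A - {b}). F (h \<circ> Transposition.transpose a b))"
proof -
  have "(\<Sum>b\<in>A. \<Sum>h | h permutes (A - {b}). F (h \<circ> Transposition.transpose a b)) =
      (\<Sum>(b, h)\<in>(SIGMA b:A. {h. h permutes (A - {b})}). F (h \<circ> Transposition.transpose a b))"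
    using fin by (intro sum.Sigma) (auto intro: finite_permutations)
  also have "\<dots> = (\<Sum>h | h permutes A. F h)"
  proof (rule sum.reindex_bij_witness[where i="\<lambda>h. (h a, h \<circ> Transposition.transpose a (h a))" and j="\<lambda>(b, h). h \<circ> Transposition.transpose a b"])
    fix x assume "x \<in> (SIGMA b:A. {h. h permutes (A - {b})})"
    then obtain b h where x: "x = (b, h)" "b \<in> A" "h permutes (A - {b})" by auto
    have hb: "h b = b" using x(3) by (auto intro: permutes_not_in)
    then show "(((case x of (b, h) \<Rightarrow> h \<circ> Transposition.transpose a b) a,
        (case x of (b, h) \<Rightarrow> h \<circ> Transposition.transpose a b) \<circ> Transposition.transpose a ((case x of (b, h) \<Rightarrow> h \<circ> Transposition.transpose a b) a)) = x)"
      using x(1) by (simp add: comp_assoc)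
    have "h permutes A" by (rule permutes_subset[OF x(3)]) auto
    then show "(case x of (b, h) \<Rightarrow> h \<circ> Transposition.transpose a b) \<in> {h. h permutes A}"
      using x a by (auto intro: permutes_compose permutes_swap_id)
    show "F (case x of (b, h) \<Rightarrow> h \<circ> Transposition.transpose a b) = (case x of (b, h) \<Rightarrow> F (h \<circ> Transposition.transpose a b))"
      using x(1) by simp
  next
    fix h assume "h \<in> {h. h permutes A}"
    then have h: "h permutes A" by simp
    show "(case (h a, h \<circ> Transposition.transpose a (h a)) of (b, h) \<Rightarrow> h \<circ> Transposition.transpose a b) = h"
      by (simp add: comp_assoc)
    have ha: "h a \<in> A" using h a by (simp add: permutes_in_image)
    have "h \<circ> Transposition.transpose a (h a) permutes A"
      using h a ha by (auto intro: permutes_compose permutes_swap_id)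
    then have "h \<circ> Transposition.transpose a (h a) permutes (A - {h a})"
      by (rule permutes_superset) auto
    then show "(h a, h \<circ> Transposition.transpose a (h a)) \<in> (SIGMA b:A. {h. h permutes (A - {b})})"
      using ha by auto
  qed
  finally show ?thesis by simp
qed

lemma sum_PiE_remove:
  fixes G :: "('a \<Rightarrow> 'b) \<Rightarrow> real"
  assumes fin: "finite A" "finite \<Gamma>" and a: "a \<in> A"
  shows "(\<Sum>g\<in>PiE A (\<lambda>_. \<Gamma>). G g) = (\<Sum>g\<in>PiE (A - {a}) (\<lambda>_. \<Gamma>). \<Sum>\<gamma>\<in>\<Gamma>. G (g(a := \<gamma>)))"
proof -
  have "(\<Sum>g\<in>PiE (A - {a}) (\<lambda>_. \<Gamma>). \<Sum>\<gamma>\<in>\<Gamma>. G (g(a := \<gamma>))) =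
      (\<Sum>(g, \<gamma>)\<in>PiE (A - {a}) (\<lambda>_. \<Gamma>) \<times> \<Gamma>. G (g(a := \<gamma>)))"
    by (rule sum.cartesian_product)
  also have "\<dots> = (\<Sum>g\<in>PiE A (\<lambda>_. \<Gamma>). G g)"
  \<comment> \<open>Tuples in \<open>PiE\<close> have the value \<open>undefined\<close> outside
    their index set, so resetting to \<open>undefined\<close> inverts the insertion of a
    component.\<close>
  proof (rule sum.reindex_bij_witness[where i="\<lambda>g. (g(a := undefined), g a)" and j="\<lambda>(g, \<gamma>). g(a := \<gamma>)"])
    fix x assume "x \<in> PiE (A - {a}) (\<lambda>_. \<Gamma>) \<times> \<Gamma>"
    then obtain g \<gamma> where x: "x = (g, \<gamma>)" "g \<in> PiE (A - {a}) (\<lambda>_. \<Gamma>)" "\<gamma> \<in> \<Gamma>" by auto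
    have "g a = undefined" using x(2) by (auto simp: PiE_iff extensional_def)
    then have ga: "g(a := undefined) = g" by (metis fun_upd_triv)
    show "((case x of (g, \<gamma>) \<Rightarrow> g(a := \<gamma>))(a := undefined), (case x of (g, \<gamma>) \<Rightarrow> g(a := \<gamma>)) a) = x"
      using x(1) ga by simp
    show "(case x of (g, \<gamma>) \<Rightarrow> g(a := \<gamma>)) \<in> PiE A (\<lambda>_. \<Gamma>)"
      using x a by (auto simp: PiE_iff extensional_def)
    show "G (case x of (g, \<gamma>) \<Rightarrow> g(a := \<gamma>)) = (case x of (g, \<gamma>) \<Rightarrow> G (g(a := \<gamma>)))"
      using x(1) by simp
  next
    fix g assume g: "g \<in> PiE A (\<lambda>_. \<Gamma>)"
    show "(case (g(a := undefined), g a) of (g, \<gamma>) \<Rightarrow> g(a := \<gamma>)) = g" by simp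
    show "(g(a := undefined), g a) \<in> PiE (A - {a}) (\<lambda>_. \<Gamma>) \<times> \<Gamma>"
      using g a by (auto simp: PiE_iff extensional_def)
  qed
  finally show ?thesis by simp
qed

section \<open>Block permutations over a finite permutation group\<close>

locale finite_perm_group =
  fixes X :: "'b set" and \<Gamma> :: "('b \<Rightarrow> 'b) set"
  assumes fin_X [simp]: "finite X"
    and perm: "\<gamma> \<in> \<Gamma> \<Longrightarrow> \<gamma> permutes X"
    and comp_closed: "\<gamma> \<in> \<Gamma> \<Longrightarrow> \<delta> \<in> \<Gamma> \<Longrightarrow> \<gamma> \<circ> \<delta> \<in> \<Gamma>"
    and inv_closed: "\<gamma> \<in> \<Gamma> \<Longrightarrow> inv' \<gamma> \<in> \<Gamma>"
    and nonempty: "\<Gamma> \<noteq> {}"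
begin

lemma finite_group [simp, intro]: "finite \<Gamma>"
  by (rule finite_subset[of _ "{\<gamma>. \<gamma> permutes X}"]) (auto simp: perm finite_permutations)

text \<open>A change of variables in the group: the components at \<open>a\<close> and
  \<open>b\<close> are exchanged for their product \<open>g b \<circ> g a\<close>, stored at
  \<open>a\<close>, and the first factor \<open>\<gamma>\<close>. This bijection is why cycle
  products of independent uniform elements are uniform.\<close>

lemma sum_PiE_merge:
  fixes G :: "('a \<Rightarrow> 'b \<Rightarrow> 'b) \<Rightarrow> real"
  assumes fin: "finite A" and a: "a \<in> A" "b \<in> A" "a \<noteq> b"
  shows "(\<Sum>g\<in>PiE A (\<lambda>_. \<Gamma>). G g) =
    (\<Sum>g\<in>PiE (A - {b}) (\<lambda>_. \<Gamma>). \<Sum>\<gamma>\<in>\<Gamma>. G (g(a := \<gamma>, b := g a \<circ> inv' \<gamma>)))"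
proof -
  have c1: "\<delta> \<circ> inv' \<gamma> \<circ> \<gamma> = \<delta>" "\<delta> \<circ> \<gamma> \<circ> inv' \<gamma> = \<delta>" if "\<gamma> \<in> \<Gamma>" for \<gamma> \<delta> :: "'b \<Rightarrow> 'b"
    using permutes_inv_o[OF perm[OF that]] by (simp_all add: comp_assoc)
  have "(\<Sum>g\<in>PiE (A - {b}) (\<lambda>_. \<Gamma>). \<Sum>\<gamma>\<in>\<Gamma>. G (g(a := \<gamma>, b := g a \<circ> inv' \<gamma>))) =
      (\<Sum>(g, \<gamma>)\<in>PiE (A - {b}) (\<lambda>_. \<Gamma>) \<times> \<Gamma>. G (g(a := \<gamma>, b := g a \<circ> inv' \<gamma>)))"
    by (rule sum.cartesian_product)
  also have "\<dots> = (\<Sum>g\<in>PiE A (\<lambda>_. \<Gamma>). G g)"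
  proof (rule sum.reindex_bij_witness[where i="\<lambda>g. (g(a := g b \<circ> g a, b := undefined), g a)"
        and j="\<lambda>(g, \<gamma>). g(a := \<gamma>, b := g a \<circ> inv' \<gamma>)"])
    fix x assume "x \<in> PiE (A - {b}) (\<lambda>_. \<Gamma>) \<times> \<Gamma>"
    then obtain g \<gamma> where x: "x = (g, \<gamma>)" "g \<in> PiE (A - {b}) (\<lambda>_. \<Gamma>)" "\<gamma> \<in> \<Gamma>" by auto
    have "g b = undefined" using x(2) by (auto simp: PiE_iff extensional_def)
    let ?j = "case x of (g, \<gamma>) \<Rightarrow> g(a := \<gamma>, b := g a \<circ> inv' \<gamma>)"
    show "(?j(a := ?j b \<circ> ?j a, b := undefined), ?j a) = x"
      using x(1) a c1(1)[OF x(3), of "g a"] fun_upd_idem[of g b undefined] \<open>g b = undefined\<close>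
      by (simp add: fun_upd_twist)
    have "g a \<in> \<Gamma>" using x(2) a by (auto simp: PiE_iff)
    then show "?j \<in> PiE A (\<lambda>_. \<Gamma>)"
      using x a comp_closed[OF _ inv_closed] by (auto simp: PiE_iff extensional_def)
    show "G ?j = (case x of (g, \<gamma>) \<Rightarrow> G (g(a := \<gamma>, b := g a \<circ> inv' \<gamma>)))"
      using x(1) by simp
  next
    fix g assume g: "g \<in> PiE A (\<lambda>_. \<Gamma>)"
    then have ga: "g a \<in> \<Gamma>" "g b \<in> \<Gamma>" using a by (auto simp: PiE_iff)
    show "(case (g(a := g b \<circ> g a, b := undefined), g a) of (g, \<gamma>) \<Rightarrow> g(a := \<gamma>, b := g a \<circ> inv' \<gamma>)) = g"
      using a c1(2)[OF ga(1), of "g b"] by (simp add: fun_upd_twist[of b a])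
    show "(g(a := g b \<circ> g a, b := undefined), g a) \<in> PiE (A - {b}) (\<lambda>_. \<Gamma>) \<times> \<Gamma>"
      using g ga a comp_closed by (auto simp: PiE_iff extensional_def)
  qed
  finally show ?thesis by simp
qed

text \<open>The wreath action in coordinates (block, position). The blocks form an arbitrary set
  \<open>A\<close> because contraction deletes arbitrary ones; the identity elsewhere is what
  \<open>permutes\<close> demands.\<close>

definition block_perm :: "nat set \<Rightarrow> (nat \<Rightarrow> 'b \<Rightarrow> 'b) \<Rightarrow> (nat \<Rightarrow> nat) \<Rightarrow> nat \<times> 'b \<Rightarrow> nat \<times> 'b" where
  "block_perm A g h = (\<lambda>(i, r). if i \<in> A \<and> r \<in> X then (h i, g i r) else (i, r))"

definition bcount :: "nat set \<Rightarrow> (nat \<Rightarrow> real) \<Rightarrow> (nat \<Rightarrow> 'b \<Rightarrow> 'b) \<Rightarrow> (nat \<Rightarrow> nat) \<Rightarrow> real \<Rightarrow> ennreal" where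
  "bcount A w g h = ocount (block_perm A g h) (A \<times> X) (\<lambda>x. w (fst x))"

lemma block_perm_permutes:
  assumes fin: "finite A" and h: "h permutes A" and g: "\<And>i. i \<in> A \<Longrightarrow> g i \<in> \<Gamma>"
  shows "block_perm A g h permutes (A \<times> X)"
proof (rule bij_imp_permutes)
  have im: "block_perm A g h ` (A \<times> X) \<subseteq> A \<times> X"
    using permutes_in_image[OF h] permutes_in_image[OF perm[OF g]]
    by (auto simp: block_perm_def simp del: atLeastAtMost_iff)
  have inj: "inj_on (block_perm A g h) (A \<times> X)"
  proof (rule inj_onI)
    fix x y assume x: "x \<in> A \<times> X" and y: "y \<in> A \<times> X"
      and eq: "block_perm A g h x = block_perm A g h y"
    obtain i r where xi: "x = (i, r)" by force
    obtain j s where yj: "y = (j, s)" by force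
    have "h i = h j" "g i r = g j s" using x y eq xi yj by (simp_all add: block_perm_def)
    then have "i = j" using permutes_inj[OF h] by (simp add: inj_eq)
    then have "r = s" using \<open>g i r = g j s\<close> permutes_inj[OF perm[OF g, of i]] x xi by (simp add: inj_eq)
    then show "x = y" using \<open>i = j\<close> xi yj by simp
  qed
  show "bij_betw (block_perm A g h) (A \<times> X) (A \<times> X)"
    using endo_inj_surj[OF _ im inj] fin inj by (simp add: bij_betw_def)
qed (auto simp: block_perm_def split: if_splits)

lemma bcount_cong:
  assumes "finite A" "h permutes A" "\<And>i. i \<in> A \<Longrightarrow> g i \<in> \<Gamma>" "\<And>i. i \<in> A \<Longrightarrow> w i = w' i"
  shows "bcount A w g h t = bcount A w' g h t"
  unfolding bcount_def using permutes_in_image[OF block_perm_permutes[OF assms(1-3)]] assms(4)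
  by (intro ocount_cong) auto

text \<open>As \<open>h\<close> fixes \<open>a\<close>, block \<open>a\<close> is invariant and
  carries a copy of \<open>\<gamma>\<close>, so its cycles split off.\<close>

lemma bcount_fixed:
  assumes fin: "finite A" and a: "a \<notin> A" and h: "h permutes A"
    and g: "\<And>i. i \<in> A \<Longrightarrow> g i \<in> \<Gamma>" and \<gamma>: "\<gamma> \<in> \<Gamma>"
  shows "bcount (insert a A) w (g(a := \<gamma>)) h t = ocount \<gamma> X (\<lambda>_. w a) t + bcount A w g h t"
proof -
  let ?f = "block_perm (insert a A) (g(a := \<gamma>)) h"
  have ha: "h a = a" using h a by (rule permutes_not_in)
  have hA: "h i \<in> A \<longleftrightarrow> i \<in> A" for i using permutes_in_image[OF h] .
  have gm: "g i r \<in> X \<longleftrightarrow> r \<in> X" if "i \<in> A" for i r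
    using permutes_in_image[OF perm[OF g[OF that]]] .
  have \<gamma>m: "\<gamma> r \<in> X \<longleftrightarrow> r \<in> X" for r
    using permutes_in_image[OF perm[OF \<gamma>]] .
  have eq: "insert a A \<times> X = ({a} \<times> X) \<union> (A \<times> X)" by auto
  have 1: "ocount ?f ({a} \<times> X) (\<lambda>x. w (fst x)) t = ocount \<gamma> X (\<lambda>_. w a) t"
  proof -
    have "{a} \<times> X = (\<lambda>r. (a, r)) ` X" by auto
    then show ?thesis using \<gamma>m a
      by (simp only:) (rule ocount_transport,
        auto simp: block_perm_def inj_on_def ha simp del: atLeastAtMost_iff)
  qed
  have 2: "ocount ?f (A \<times> X) (\<lambda>x. w (fst x)) t = bcount A w g h t"
    unfolding bcount_def
    using a hA gm by (intro ocount_cong) (auto simp: block_perm_def simp del: atLeastAtMost_iff)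
  have "bcount (insert a A) w (g(a := \<gamma>)) h t =
      ocount ?f ({a} \<times> X) (\<lambda>x. w (fst x)) t + ocount ?f (A \<times> X) (\<lambda>x. w (fst x)) t"
    unfolding bcount_def eq
    using a hA gm \<gamma>m fin ha
    by (intro ocount_Un) (auto simp: block_perm_def simp del: atLeastAtMost_iff)
  then show ?thesis by (simp add: 1 2)
qed

text \<open>The first return to the blocks of \<open>A\<close>: a point of block \<open>a\<close>
  enters block \<open>b\<close> by \<open>\<gamma>\<close> and leaves it by
  \<open>g a \<circ> inv' \<gamma>\<close>. So \<open>\<gamma>\<close> cancels and the count does
  not depend on it.\<close>

lemma bcount_merge:
  assumes fin: "finite A" and a: "a \<in> A" and b: "b \<notin> A" and h: "h permutes A"
    and g: "\<And>i. i \<in> A \<Longrightarrow> g i \<in> \<Gamma>" and \<gamma>: "\<gamma> \<in> \<Gamma>"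
  shows "bcount (insert b A) w (g(a := \<gamma>, b := g a \<circ> inv' \<gamma>)) (h \<circ> Transposition.transpose a b) t =
    bcount A (w(a := w a + w b)) g h t"
proof -
  let ?g = "g(a := \<gamma>, b := g a \<circ> inv' \<gamma>)"
  let ?h = "h \<circ> Transposition.transpose a b"
  let ?f = "block_perm (insert b A) ?g ?h"
  have hb: "h b = b" using h b by (rule permutes_not_in)
  have hA: "h i \<in> A \<longleftrightarrow> i \<in> A" for i using permutes_in_image[OF h] .
  have ab: "a \<noteq> b" using a b by auto
  have gm: "g i r \<in> X \<longleftrightarrow> r \<in> X" if "i \<in> A" for i r
    using permutes_in_image[OF perm[OF g[OF that]]] .
  have \<gamma>m: "\<gamma> r \<in> X \<longleftrightarrow> r \<in> X" for r
    using permutes_in_image[OF perm[OF \<gamma>]] .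
  have \<gamma>i: "inv' \<gamma> (\<gamma> r) = r" for r using permutes_inverses(2)[OF perm[OF \<gamma>]] .
  have hp: "?h permutes insert b A"
    using a by (intro permutes_compose permutes_swap_id permutes_subset[OF h]) auto
  have gp: "?g i \<in> \<Gamma>" if "i \<in> insert b A" for i
    using that g a \<gamma> comp_closed[OF g[OF a] inv_closed[OF \<gamma>]] by auto
  have fa: "?f (a, r) = (b, \<gamma> r)" if "r \<in> X" for r
    using that a ab hb by (simp add: block_perm_def)
  have fb: "?f (b, r) = (h a, g a (inv' \<gamma> r))" if "r \<in> X" for r
    using that ab by (simp add: block_perm_def)
  have fo: "?f (i, r) = (h i, g i r)" if "r \<in> X" "i \<in> A" "i \<noteq> a" for i r
  proof -
    have "i \<noteq> b" using that b by auto
    then show ?thesis using that by (simp add: block_perm_def Transposition.transpose_def)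
  qed
  have f': "block_perm A g h (i, r) = (h i, g i r)" if "r \<in> X" "i \<in> A" for i r
    using that by (simp add: block_perm_def)
  have f'2: "block_perm A g h y = (if ?f y \<in> A \<times> X then ?f y else ?f (?f y)) \<and>
     (w(a := w a + w b)) (fst y) = (if ?f y \<in> A \<times> X then w (fst y) else w (fst y) + w (fst (?f y)))"
    if y: "y \<in> A \<times> X" for y
  proof -
    obtain i r where yi: "y = (i, r)" "i \<in> A" "r \<in> X" using y by auto
    show ?thesis
    proof (cases "i = a")
      case True
      have "\<gamma> r \<in> X" using yi \<gamma>m by simp
      then show ?thesis unfolding yi(1) True
        using yi a b by (simp add: fa fb f' \<gamma>i del: atLeastAtMost_iff)
    next
      case False
      then show ?thesis unfolding yi(1)
        using yi hA[of i] gm[of i r] by (simp add: fo f' del: atLeastAtMost_iff)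
    qed
  qed
  show ?thesis unfolding bcount_def
  proof (rule ocount_first_return)
    show "?f permutes insert b A \<times> X"
      using fin hp gp by (intro block_perm_permutes) auto
    fix x assume "x \<in> insert b A \<times> X - A \<times> X"
    then obtain r where x: "x = (b, r)" "r \<in> X" by auto
    have "inv' \<gamma> r \<in> X"
      using permutes_in_image[OF perm[OF inv_closed[OF \<gamma>]], of r] x(2) by blast
    then show "?f x \<in> A \<times> X" unfolding x(1) fb[OF x(2)] using hA[of a] gm[OF a] a by simp
  qed (use fin f'2 in auto)
qed

text \<open>An unnormalised mean over the wreath product on the blocks \<open>A\<close>. Weights
  vary between blocks and \<open>c\<close> carries the cycles already split off, so that
  \<open>wsum_rec\<close> stays within this form.\<close>

definition wsum :: "((real \<Rightarrow> ennreal) \<Rightarrow> real) \<Rightarrow> nat set \<Rightarrow> (nat \<Rightarrow> real) \<Rightarrow> (real \<Rightarrow> ennreal) \<Rightarrow> real" where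
  "wsum Q A w c = (\<Sum>g\<in>PiE A (\<lambda>_. \<Gamma>). \<Sum>h | h permutes A. Q (\<lambda>t. c t + bcount A w g h t))"

lemma wsum_cong:
  assumes "finite A" "\<And>i. i \<in> A \<Longrightarrow> w i = w' i"
  shows "wsum Q A w c = wsum Q A w' c"
  unfolding wsum_def
  by (intro sum.cong refl arg_cong[where f=Q] ext arg_cong2[where f="(+)"] bcount_cong)
     (use assms in \<open>auto simp: PiE_iff\<close>)

text \<open>Summand \<open>b\<close> collects the \<open>h\<close> with \<open>h a = b\<close>. If \<open>b \<noteq> a\<close>, block \<open>b\<close> is contracted into block
  \<open>a\<close>, which carries the product of the two group elements and the sum of the two weights.\<close>

lemma wsum_rec:
  assumes fin: "finite A" and a: "a \<in> A"
  shows "wsum Q A w c =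
    (\<Sum>\<gamma>\<in>\<Gamma>. wsum Q (A - {a}) w (\<lambda>t. c t + ocount \<gamma> X (\<lambda>_. w a) t)) +
    (\<Sum>b\<in>A - {a}. real (card \<Gamma>) * wsum Q (A - {b}) (w(a := w a + w b)) c)"
proof -
  let ?F = "\<lambda>g h. Q (\<lambda>t. c t + bcount A w g h t)"
  have "wsum Q A w c = (\<Sum>g\<in>PiE A (\<lambda>_. \<Gamma>). \<Sum>b\<in>A. \<Sum>h | h permutes (A - {b}). ?F g (h \<circ> Transposition.transpose a b))"
    unfolding wsum_def by (subst sum_permutes_split[OF fin a]) simp
  also have "\<dots> = (\<Sum>b\<in>A. \<Sum>g\<in>PiE A (\<lambda>_. \<Gamma>). \<Sum>h | h permutes (A - {b}). ?F g (h \<circ> Transposition.transpose a b))"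
    by (rule sum.swap)
  also have "\<dots> = (\<Sum>g\<in>PiE A (\<lambda>_. \<Gamma>). \<Sum>h | h permutes (A - {a}). ?F g (h \<circ> Transposition.transpose a a)) +
     (\<Sum>b\<in>A - {a}. \<Sum>g\<in>PiE A (\<lambda>_. \<Gamma>). \<Sum>h | h permutes (A - {b}). ?F g (h \<circ> Transposition.transpose a b))"
    using fin a by (rule sum.remove)
  also have "(\<Sum>g\<in>PiE A (\<lambda>_. \<Gamma>). \<Sum>h | h permutes (A - {a}). ?F g (h \<circ> Transposition.transpose a a)) =
     (\<Sum>g\<in>PiE (A - {a}) (\<lambda>_. \<Gamma>). \<Sum>\<gamma>\<in>\<Gamma>. \<Sum>h | h permutes (A - {a}). ?F (g(a := \<gamma>)) h)"
    by (subst sum_PiE_remove[OF fin finite_group a]) simp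
  also have "\<dots> = (\<Sum>\<gamma>\<in>\<Gamma>. wsum Q (A - {a}) w (\<lambda>t. c t + ocount \<gamma> X (\<lambda>_. w a) t))"
    unfolding wsum_def
  proof (subst sum.swap, intro sum.cong refl arg_cong[where f=Q] ext)
    fix \<gamma> g h t assume *: "\<gamma> \<in> \<Gamma>" "g \<in> PiE (A - {a}) (\<lambda>_. \<Gamma>)" "h \<in> {h. h permutes (A - {a})}"
    have "bcount (insert a (A - {a})) w (g(a := \<gamma>)) h t =
        ocount \<gamma> X (\<lambda>_. w a) t + bcount (A - {a}) w g h t"
      using * fin by (intro bcount_fixed) (auto simp: PiE_iff)
    then show "c t + bcount A w (g(a := \<gamma>)) h t =
        c t + ocount \<gamma> X (\<lambda>_. w a) t + bcount (A - {a}) w g h t"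
      using a by (simp add: insert_absorb add.assoc)
  qed
  also have "(\<Sum>b\<in>A - {a}. \<Sum>g\<in>PiE A (\<lambda>_. \<Gamma>). \<Sum>h | h permutes (A - {b}). ?F g (h \<circ> Transposition.transpose a b)) =
     (\<Sum>b\<in>A - {a}. real (card \<Gamma>) * wsum Q (A - {b}) (w(a := w a + w b)) c)"
  proof (rule sum.cong[OF refl])
    fix b assume b: "b \<in> A - {a}"
    have "(\<Sum>g\<in>PiE A (\<lambda>_. \<Gamma>). \<Sum>h | h permutes (A - {b}). ?F g (h \<circ> Transposition.transpose a b)) =
      (\<Sum>g\<in>PiE (A - {b}) (\<lambda>_. \<Gamma>). \<Sum>\<gamma>\<in>\<Gamma>. \<Sum>h | h permutes (A - {b}).
         ?F (g(a := \<gamma>, b := g a \<circ> inv' \<gamma>)) (h \<circ> Transposition.transpose a b))"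
      using b a fin by (intro sum_PiE_merge) auto
    \<comment> \<open>After the merge the summand is independent of \<open>\<gamma>\<close>, which
      produces the factor \<open>card \<Gamma>\<close>.\<close>
    also have "\<dots> = (\<Sum>g\<in>PiE (A - {b}) (\<lambda>_. \<Gamma>). \<Sum>\<gamma>\<in>\<Gamma>. \<Sum>h | h permutes (A - {b}).
         Q (\<lambda>t. c t + bcount (A - {b}) (w(a := w a + w b)) g h t))"
    proof (intro sum.cong refl arg_cong[where f=Q] ext)
      fix \<gamma> g h t assume *: "\<gamma> \<in> \<Gamma>" "g \<in> PiE (A - {b}) (\<lambda>_. \<Gamma>)" "h \<in> {h. h permutes (A - {b})}"
      have "bcount (insert b (A - {b})) w (g(a := \<gamma>, b := g a \<circ> inv' \<gamma>)) (h \<circ> Transposition.transpose a b) t =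
          bcount (A - {b}) (w(a := w a + w b)) g h t"
        using * fin a b by (intro bcount_merge) (auto simp: PiE_iff)
      then show "c t + bcount A w (g(a := \<gamma>, b := g a \<circ> inv' \<gamma>)) (h \<circ> Transposition.transpose a b) t =
          c t + bcount (A - {b}) (w(a := w a + w b)) g h t"
        using b by (simp add: insert_absorb)
    qed
    also have "\<dots> = real (card \<Gamma>) * wsum Q (A - {b}) (w(a := w a + w b)) c"
      by (simp add: wsum_def sum_distrib_left)
    finally show "(\<Sum>g\<in>PiE A (\<lambda>_. \<Gamma>). \<Sum>h | h permutes (A - {b}). ?F g (h \<circ> Transposition.transpose a b)) =
      real (card \<Gamma>) * wsum Q (A - {b}) (w(a := w a + w b)) c" .
  qed
  finally show ?thesis .
qed

end

section \<open>The chain of cycle sizes\<close>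

context finite_perm_group
begin

text \<open>Mean of \<open>Q\<close> for the chain that removes \<open>n - r\<close> blocks at once, \<open>r\<close> uniform below \<open>n\<close>; the
  accumulator \<open>c\<close> counts the parts found so far.\<close>

fun bval :: "real \<Rightarrow> ((real \<Rightarrow> ennreal) \<Rightarrow> real) \<Rightarrow> nat \<Rightarrow> (real \<Rightarrow> ennreal) \<Rightarrow> real" where
  "bval \<kappa> Q 0 c = Q c"
| "bval \<kappa> Q (Suc n) c = (\<Sum>r\<le>n. \<Sum>\<gamma>\<in>\<Gamma>.
     bval \<kappa> Q r (\<lambda>t. c t + ocount \<gamma> X (\<lambda>_. real (Suc n - r) * \<kappa>) t)) / (real (Suc n) * real (card \<Gamma>))"

lemma card_group_pos: "0 < card \<Gamma>"
  using nonempty by (simp add: card_gt_0_iff)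

text \<open>In \<open>?M\<close> the block \<open>a\<close> stands for \<open>k\<close> merged
  blocks. Expanding at \<open>a\<close> either closes its cycle and leaves unmarked blocks, which is
  \<open>?P\<close>, or absorbs another block, which is \<open>?M\<close> with \<open>k + 1\<close>.
  Each number \<open>r\<close> of blocks never absorbed gets the same factor, so the cycle size is
  uniform. With \<open>k = 1\<close>, \<open>?M n\<close> yields \<open>?P (Suc n)\<close>.\<close>

lemma wsum_eq_bval_aux:
  "(\<forall>A c. finite A \<longrightarrow> card A = n \<longrightarrow> wsum Q A (\<lambda>_. \<kappa>) c = real (card \<Gamma>) ^ n * fact n * bval \<kappa> Q n c) \<and>
   (\<forall>A a k c. finite A \<longrightarrow> card A = Suc n \<longrightarrow> a \<in> A \<longrightarrow>
     wsum Q A ((\<lambda>_. \<kappa>)(a := real k * \<kappa>)) c = real (card \<Gamma>) ^ n * fact n *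
       (\<Sum>r\<le>n. \<Sum>\<gamma>\<in>\<Gamma>. bval \<kappa> Q r (\<lambda>t. c t + ocount \<gamma> X (\<lambda>_. real (n - r + k) * \<kappa>) t)))"
  (is "?P n \<and> ?M n")
proof -
  define G where "G = real (card \<Gamma>)"
  have G: "G > 0" using card_group_pos by (simp add: G_def)
  let ?S = "\<lambda>n k c. \<Sum>r\<le>n. \<Sum>\<gamma>\<in>\<Gamma>. bval \<kappa> Q r (\<lambda>t. c t + ocount \<gamma> X (\<lambda>_. real (n - r + k) * \<kappa>) t)"
  have step: "wsum Q A ((\<lambda>_. \<kappa>)(a := real k * \<kappa>)) c =
      G ^ n * fact n * (\<Sum>\<gamma>\<in>\<Gamma>. bval \<kappa> Q n (\<lambda>t. c t + ocount \<gamma> X (\<lambda>_. real k * \<kappa>) t)) +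
      (\<Sum>b\<in>A - {a}. G * wsum Q (A - {b}) ((\<lambda>_. \<kappa>)(a := real (Suc k) * \<kappa>)) c)"
    if P: "?P n" and A: "finite A" "card A = Suc n" "a \<in> A" for n A a k c
  proof -
    let ?w = "(\<lambda>_. \<kappa>)(a := real k * \<kappa>)"
    have cA: "card (A - {a}) = n" using A by simp
    have "(\<Sum>\<gamma>\<in>\<Gamma>. wsum Q (A - {a}) ?w (\<lambda>t. c t + ocount \<gamma> X (\<lambda>_. ?w a) t)) =
      (\<Sum>\<gamma>\<in>\<Gamma>. wsum Q (A - {a}) (\<lambda>_. \<kappa>) (\<lambda>t. c t + ocount \<gamma> X (\<lambda>_. real k * \<kappa>) t))"
      using A(1) by (intro sum.cong refl) (subst wsum_cong[of "A - {a}" ?w "\<lambda>_. \<kappa>"], auto)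
    also have "\<dots> = (\<Sum>\<gamma>\<in>\<Gamma>. G ^ n * fact n * bval \<kappa> Q n (\<lambda>t. c t + ocount \<gamma> X (\<lambda>_. real k * \<kappa>) t))"
      using P A(1) cA by (simp add: G_def)
    finally have 1: "(\<Sum>\<gamma>\<in>\<Gamma>. wsum Q (A - {a}) ?w (\<lambda>t. c t + ocount \<gamma> X (\<lambda>_. ?w a) t)) =
       G ^ n * fact n * (\<Sum>\<gamma>\<in>\<Gamma>. bval \<kappa> Q n (\<lambda>t. c t + ocount \<gamma> X (\<lambda>_. real k * \<kappa>) t))"
      by (simp add: sum_distrib_left)
    have 2: "?w(a := ?w a + ?w b) = (\<lambda>_. \<kappa>)(a := real (Suc k) * \<kappa>)" if "b \<in> A - {a}" for b
      using that by (auto simp: algebra_simps)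
    show ?thesis
      unfolding wsum_rec[OF A(1,3)] 1 G_def[symmetric]
      by (intro arg_cong2[where f="(+)"] refl sum.cong) (simp only: 2)
  qed
  have PS: "?P (Suc n)" if M: "?M n" for n
  proof (intro allI impI)
    fix A c assume A: "finite (A :: nat set)" "card A = Suc n"
    then obtain a where a: "a \<in> A" by (metis card_eq_SucD insertI1)
    have "wsum Q A (\<lambda>_. \<kappa>) c = wsum Q A ((\<lambda>_. \<kappa>)(a := real 1 * \<kappa>)) c"
      by (simp add: fun_upd_idem)
    also have "\<dots> = G ^ n * fact n * ?S n 1 c"
      using M A a unfolding G_def by blast
    also have "?S n 1 c = (\<Sum>r\<le>n. \<Sum>\<gamma>\<in>\<Gamma>. bval \<kappa> Q r (\<lambda>t. c t + ocount \<gamma> X (\<lambda>_. real (Suc n - r) * \<kappa>) t))"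
      by (intro sum.cong refl) (simp add: Suc_diff_le)
    also have "\<dots> = real (Suc n) * G * bval \<kappa> Q (Suc n) c"
      using G by (simp add: G_def)
    finally show "wsum Q A (\<lambda>_. \<kappa>) c = real (card \<Gamma>) ^ Suc n * fact (Suc n) * bval \<kappa> Q (Suc n) c"
      by (simp add: G_def algebra_simps)
  qed
  show ?thesis
  proof (induction n)
    case 0
    have P0: "?P 0"
      by (auto simp: wsum_def bcount_def ocount_def)
    moreover have "?M 0"
    proof (intro allI impI)
      fix A a k c assume A: "finite (A :: nat set)" "card A = Suc 0" "a \<in> A"
      then have e: "A - {a} = {}" by (metis card_1_singletonE One_nat_def Diff_cancel singletonD)
      have "wsum Q A ((\<lambda>_. \<kappa>)(a := real k * \<kappa>)) c = G ^ 0 * fact 0 *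
          (\<Sum>\<gamma>\<in>\<Gamma>. bval \<kappa> Q 0 (\<lambda>t. c t + ocount \<gamma> X (\<lambda>_. real k * \<kappa>) t))"
        using step[OF P0 A, of k c] unfolding e sum.empty add_0_right .
      then show "wsum Q A ((\<lambda>_. \<kappa>)(a := real k * \<kappa>)) c = real (card \<Gamma>) ^ 0 * fact 0 * ?S 0 k c"
        by simp
    qed
    ultimately show ?case ..
  next
    case (Suc n)
    have P: "?P (Suc n)" by (rule PS) (rule conjunct2[OF Suc])
    moreover have "?M (Suc n)"
    proof (intro allI impI)
      fix A a k c assume A: "finite (A :: nat set)" "card A = Suc (Suc n)" "a \<in> A"
      let ?B = "\<lambda>r i. \<Sum>\<gamma>\<in>\<Gamma>. bval \<kappa> Q r (\<lambda>t. c t + ocount \<gamma> X (\<lambda>_. real i * \<kappa>) t)"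
      have M: "wsum Q (A - {b}) ((\<lambda>_. \<kappa>)(a := real (Suc k) * \<kappa>)) c = G ^ n * fact n * ?S n (Suc k) c"
        if "b \<in> A - {a}" for b
      proof -
        have "card (A - {b}) = Suc n" "a \<in> A - {b}" using A that by auto
        then show ?thesis
          unfolding G_def using conjunct2[OF Suc, rule_format, of "A - {b}" a "Suc k" c] A(1) by (simp only: finite_Diff)
      qed
      have "wsum Q A ((\<lambda>_. \<kappa>)(a := real k * \<kappa>)) c =
        G ^ Suc n * fact (Suc n) * ?B (Suc n) k + (\<Sum>b\<in>A - {a}. G * (G ^ n * fact n * ?S n (Suc k) c))"
        unfolding step[OF P A] by (intro arg_cong2[where f="(+)"] refl sum.cong) (simp only: M)
      \<comment> \<open>The \<open>Suc n\<close> choices of \<open>b\<close> turn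
        \<open>fact n\<close> into \<open>fact (Suc n)\<close>, so both terms share one
        prefactor.\<close>
      also have "\<dots> = G ^ Suc n * fact (Suc n) * (?S n (Suc k) c + ?B (Suc n) k)"
        using A by (simp add: algebra_simps)
      also have "?S n (Suc k) c = (\<Sum>r\<le>n. ?B r (Suc n - r + k))"
      proof (rule sum.cong[OF refl])
        fix r assume "r \<in> {..n}"
        then have "n - r + Suc k = Suc n - r + k" by auto
        then show "?B r (n - r + Suc k) = ?B r (Suc n - r + k)" by (simp only:)
      qed
      also have "(\<Sum>r\<le>n. ?B r (Suc n - r + k)) + ?B (Suc n) k = ?S (Suc n) k c"
        by simp
      finally show "wsum Q A ((\<lambda>_. \<kappa>)(a := real k * \<kappa>)) c = real (card \<Gamma>) ^ Suc n * fact (Suc n) * ?S (Suc n) k c"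
        by (simp only: G_def)
    qed
    ultimately show ?case ..
  qed
qed

lemma wsum_eq_bval:
  assumes "finite A" "card A = n"
  shows "wsum Q A (\<lambda>_. \<kappa>) c = real (card \<Gamma>) ^ n * fact n * bval \<kappa> Q n c"
  using wsum_eq_bval_aux assms by blast

end

section \<open>Stick breaking rounded to a grid\<close>

abbreviation U01 :: "real measure" where
  "U01 \<equiv> uniform_measure lborel {0..1::real}"

abbreviation SU :: "(nat \<Rightarrow> real) measure" where
  "SU \<equiv> PiM UNIV (\<lambda>_. U01)"

lemma prob_space_U01: "prob_space U01"
  by (rule prob_space_uniform_measure) auto

lemma AE_U01: "AE u in U01. u \<in> {0..1}"
  by (rule AE_uniform_measureI) auto

text \<open>In terms of \<open>u\<close>, each cell below the current one has length
  \<open>1 / s\<close> and the current one keeps \<open>(s - n) / s\<close>. The equal lengths make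
  the integer part uniform once the cell is left.\<close>

lemma floor_cell:
  fixes s u :: real
  assumes n: "real n \<le> s" "s < real n + 1" "0 < s" and u: "u \<in> {0..1}"
  shows "nat \<lfloor>s * (1 - u)\<rfloor> \<le> n"
    "r < n \<Longrightarrow> nat \<lfloor>s * (1 - u)\<rfloor> = r \<longleftrightarrow> u \<in> {1 - (real r + 1) / s<..1 - real r / s}"
    "nat \<lfloor>s * (1 - u)\<rfloor> = n \<longleftrightarrow> u \<in> {0..1 - real n / s}"
proof -
  have y: "0 \<le> s * (1 - u)" "s * (1 - u) \<le> s" using u n(3) by (simp_all add: mult_left_le)
  then show "nat \<lfloor>s * (1 - u)\<rfloor> \<le> n" using n by linarith
  have c: "nat \<lfloor>s * (1 - u)\<rfloor> = r \<longleftrightarrow> real r \<le> s * (1 - u) \<and> s * (1 - u) < real r + 1" for r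
    using y by linarith
  have d: "real r \<le> s * (1 - u) \<longleftrightarrow> u \<le> 1 - real r / s" for r
    using n(3) by (simp add: field_simps)
  have e: "s * (1 - u) < real r + 1 \<longleftrightarrow> 1 - (real r + 1) / s < u" for r
    using n(3) by (simp add: field_simps)
  show "nat \<lfloor>s * (1 - u)\<rfloor> = r \<longleftrightarrow> u \<in> {1 - (real r + 1) / s<..1 - real r / s}"
    unfolding c d e by auto
  have "s * (1 - u) < real n + 1" using y n by linarith
  then show "nat \<lfloor>s * (1 - u)\<rfloor> = n \<longleftrightarrow> u \<in> {0..1 - real n / s}"
    unfolding c d using u by auto
qed

lemma nn_integral_floor_cells:
  fixes s :: real and a :: "nat \<Rightarrow> real"
  assumes n: "real n \<le> s" "s < real n + 1" "0 < s" and a: "\<And>r. 0 \<le> a r"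
  shows "(\<integral>\<^sup>+u. ennreal (a (nat \<lfloor>s * (1 - u)\<rfloor>)) \<partial>U01) = ennreal (((\<Sum>r<n. a r) + (s - real n) * a n) / s)"
proof -
  let ?I = "\<lambda>r. if r < n then {1 - (real r + 1) / s<..1 - real r / s} else {0..1 - real n / s}"
  let ?l = "\<lambda>r. if r < n then 1 / s else (s - real n) / s"
  have I01: "?I r \<subseteq> {0..1}" if "r \<le> n" for r
  proof (cases "r < n")
    case True
    then have "real r + 1 \<le> s" using n(1) by linarith
    then have "(real r + 1) / s \<le> 1" "0 \<le> real r / s" using n(3) by simp_all
    then show ?thesis using True by auto
  next
    case False
    have "0 \<le> real n / s" using n(3) by simp
    then show ?thesis using False by auto
  qed
  have l: "emeasure lborel (?I r) = ennreal (?l r)" if "r \<le> n" for r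
  proof (cases "r < n")
    case True
    have "1 - (real r + 1) / s \<le> 1 - real r / s" using n(3) by (simp add: field_simps)
    moreover have "1 - real r / s - (1 - (real r + 1) / s) = 1 / s" using n(3) by (simp add: field_simps)
    ultimately show ?thesis using True by simp
  next
    case False
    have "real n / s \<le> 1" "1 - real n / s = (s - real n) / s" using n by (simp_all add: field_simps)
    then show ?thesis using False by simp
  qed
  have [measurable]: "(\<lambda>u. ennreal (a (nat \<lfloor>s * (1 - u)\<rfloor>))) \<in> borel_measurable lborel"
  proof -
    have "(\<lambda>u. nat \<lfloor>s * (1 - u)\<rfloor>) \<in> measurable lborel (count_space UNIV)" by measurable
    then show ?thesis by (rule measurable_compose) simp
  qed
  have eq: "ennreal (a (nat \<lfloor>s * (1 - u)\<rfloor>)) * indicator {0..1} u = (\<Sum>r\<le>n. ennreal (a r) * indicator (?I r) u)"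
    for u :: real
  proof (cases "u \<in> {0..1}")
    case True
    let ?r = "nat \<lfloor>s * (1 - u)\<rfloor>"
    have iff: "u \<in> ?I r \<longleftrightarrow> ?r = r" if "r \<le> n" for r
      using floor_cell(2)[OF n True, of r] floor_cell(3)[OF n True] that
      by (cases "r < n") (simp_all only: if_True if_False, use le_antisym not_less in blast)
    have "(\<Sum>r\<le>n. ennreal (a r) * indicator (?I r) u) = (\<Sum>r\<le>n. if ?r = r then ennreal (a r) else 0)"
      using iff by (intro sum.cong refl) (simp only: indicator_def atMost_iff, simp)
    also have "\<dots> = ennreal (a ?r)" using floor_cell(1)[OF n True] by (simp add: sum.delta')
    finally show ?thesis using True by simp
  next
    case False
    have "u \<notin> ?I r" if "r \<le> n" for r using I01[OF that] False by blast
    then show ?thesis using False by (simp add: indicator_def)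
  qed
  have "(\<integral>\<^sup>+u. ennreal (a (nat \<lfloor>s * (1 - u)\<rfloor>)) \<partial>U01) =
      (\<integral>\<^sup>+u. (\<Sum>r\<le>n. ennreal (a r) * indicator (?I r) u) \<partial>lborel)"
    by (subst nn_integral_uniform_measure) (simp_all only: eq, simp_all add: divide_ennreal_def)
  also have "\<dots> = (\<Sum>r\<le>n. ennreal (a r) * ennreal (?l r))"
    by (subst nn_integral_sum) (auto simp: nn_integral_cmult_indicator l simp del: emeasure_lborel_Ioc emeasure_lborel_Icc intro!: sum.cong)
  also have "\<dots> = (\<Sum>r\<le>n. ennreal (a r * ?l r))"
    using n a by (intro sum.cong refl ennreal_mult[symmetric]) auto
  also have "\<dots> = ennreal (\<Sum>r\<le>n. a r * ?l r)"
    using n a by (intro sum_ennreal) auto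
  also have "(\<Sum>r\<le>n. a r * ?l r) = (\<Sum>r<n. a r * (1 / s)) + a n * ((s - real n) / s)"
    by (simp add: lessThan_Suc_atMost[symmetric])
  also have "\<dots> = ((\<Sum>r<n. a r) + (s - real n) * a n) / s"
    by (simp add: sum_divide_distrib add_divide_distrib)
  finally show ?thesis .
qed

lemma nn_integral_cells_le:
  fixes s :: real and a :: "nat \<Rightarrow> real"
  assumes "real n \<le> s" "s < real n + 1" "0 < s" "\<And>r. 0 \<le> a r"
    and "\<And>u. u \<in> {0..1} \<Longrightarrow> f u \<le> ennreal (a (nat \<lfloor>s * (1 - u)\<rfloor>))"
  shows "(\<integral>\<^sup>+u. f u \<partial>U01) \<le> ennreal (((\<Sum>r<n. a r) + (s - real n) * a n) / s)"
  unfolding nn_integral_floor_cells[where a=a, OF assms(1-4), symmetric]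
  by (rule nn_integral_mono_AE) (use AE_U01 assms(5) in auto)

lemma nn_integral_cells_ge:
  fixes s :: real and a :: "nat \<Rightarrow> real"
  assumes "real n \<le> s" "s < real n + 1" "0 < s" "\<And>r. 0 \<le> a r"
    and "\<And>u. u \<in> {0..1} \<Longrightarrow> ennreal (a (nat \<lfloor>s * (1 - u)\<rfloor>)) \<le> f u"
  shows "ennreal (((\<Sum>r<n. a r) + (s - real n) * a n) / s) \<le> (\<integral>\<^sup>+u. f u \<partial>U01)"
  unfolding nn_integral_floor_cells[where a=a, OF assms(1-4), symmetric]
  by (rule nn_integral_mono_AE) (use AE_U01 assms(5) in auto)

definition rest :: "(nat \<Rightarrow> real) \<Rightarrow> nat \<Rightarrow> real" where
  "rest U i = (\<Prod>r<i. 1 - U r)"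

lemma rest_0 [simp]: "rest U 0 = 1"
  by (simp add: rest_def)

text \<open>Self-similarity: after the first break the process starts afresh, scaled by
  \<open>1 - u\<close>. All recursions in \<open>s\<close> rest on this.\<close>

lemma rest_case_nat: "rest (case_nat u U) (Suc i) = (1 - u) * rest U i"
  by (simp add: rest_def prod.lessThan_Suc_shift del: prod.lessThan_Suc)

lemma stick_eq_rest: "stick U i = rest U i - rest U (Suc i)"
  by (simp add: stick_def rest_def algebra_simps)

lemma rest_bounds:
  assumes "\<And>i. U i \<in> {0..1}"
  shows "0 \<le> rest U i" "rest U i \<le> 1"
  using assms unfolding rest_def by (auto intro!: prod_nonneg prod_le_1)

lemma measurable_rest [measurable]: "(\<lambda>U. rest U i) \<in> borel_measurable SU"
  unfolding rest_def by measurable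

lemma AE_SU: "AE U in SU. \<forall>i. U i \<in> {0..1}"
  unfolding AE_all_countable
  by (intro allI AE_PiM_component AE_U01) (auto intro: prob_space_U01)

text \<open>An iid sequence is its first term followed by an independent copy of the whole
  sequence.\<close>

lemma nn_integral_sequence_split:
  assumes M: "prob_space M" and f [measurable]: "f \<in> borel_measurable (PiM (UNIV :: nat set) (\<lambda>_. M))"
  shows "(\<integral>\<^sup>+U. f U \<partial>PiM UNIV (\<lambda>_. M)) = (\<integral>\<^sup>+u. \<integral>\<^sup>+U. f (case_nat u U) \<partial>PiM UNIV (\<lambda>_. M) \<partial>M)"
proof -
  interpret prob_space M by (rule M)
  interpret S: sequence_space M by unfold_locales
  let ?S = "PiM (UNIV :: nat set) (\<lambda>_. M)"
  have [measurable]: "(\<lambda>(u, U). case_nat u U) \<in> measurable (M \<Otimes>\<^sub>M ?S) ?S" by measurable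
  have "(\<integral>\<^sup>+U. f U \<partial>?S) = (\<integral>\<^sup>+U. f U \<partial>distr (M \<Otimes>\<^sub>M ?S) ?S (\<lambda>(u, U). case_nat u U))"
    by (subst S.PiM_iter) simp
  also have "\<dots> = (\<integral>\<^sup>+x. f ((\<lambda>(u, U). case_nat u U) x) \<partial>(M \<Otimes>\<^sub>M ?S))"
    by (rule nn_integral_distr) measurable
  also have "\<dots> = (\<integral>\<^sup>+u. \<integral>\<^sup>+U. f (case_nat u U) \<partial>?S \<partial>M)"
    by (subst S.P.nn_integral_fst[symmetric]) (simp_all add: case_prod_beta)
  finally show ?thesis .
qed

text \<open>It makes \<open>2 * harm n\<close> solve the cost recursion: the average of
  \<open>2 + 2 * harm r\<close> over \<open>r < n\<close> is \<open>2 * harm n\<close>.\<close>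

lemma sum_harm: "(\<Sum>r<n. harm r :: real) = real n * harm n - real n"
proof (induction n)
  case (Suc n)
  have "real (Suc n) * harm (Suc n) = real (Suc n) * harm n + 1"
    unfolding harm_Suc by (simp add: distrib_left del: of_nat_Suc)
  then show ?case using Suc by (simp add: distrib_right)
qed simp

text \<open>A step inside the cell of \<open>s\<close> only lowers the fractional part, so such steps are paid by the
  potential \<open>frac\<close>; a step to another cell costs at most 2, and the expected number of those
  is the harmonic number.\<close>

lemma expected_frac_variation:
  assumes "0 \<le> s"
  shows "(\<integral>\<^sup>+U. (\<Sum>i<k. ennreal \<bar>frac (s * rest U i) - frac (s * rest U (Suc i))\<bar>) \<partial>SU)
    \<le> ennreal (frac s + 2 * harm (nat \<lfloor>s\<rfloor>))"
  using assms
proof (induction k arbitrary: s)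
  case 0
  then show ?case by simp
next
  case (Suc k)
  interpret S: prob_space SU by (rule prob_space_PiM) (rule prob_space_U01)
  define n where "n = nat \<lfloor>s\<rfloor>"
  let ?L = "\<lambda>k s U. (\<Sum>i<k. ennreal \<bar>frac (s * rest U i) - frac (s * rest U (Suc i))\<bar>)"
  have [measurable]: "(\<lambda>U. frac (s * rest U i)) \<in> borel_measurable SU" for s i
    unfolding frac_def by measurable
  have [measurable]: "?L k s \<in> borel_measurable SU" for k s by measurable
  show ?case
  proof (cases "s = 0")
    case True
    then show ?thesis by simp
  next
    case False
    then have s: "0 < s" using Suc.prems by simp
    have n: "real n \<le> s" "s < real n + 1" using s by (simp_all add: n_def)
    have fr: "frac s = s - real n" using s by (simp add: n_def frac_def)
    \<comment> \<open>Bounds the first step plus the later cost by the cell reached. For fractional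
      parts \<open>p\<close> before and \<open>q\<close> after, \<open>\<bar>p - q\<bar> + q\<close>
      is at most \<open>p + 2\<close>, and it equals \<open>p\<close> when \<open>q \<le> p\<close>,
      as happens within the cell.\<close>
    define b where "b r = (if r < n then frac s + 2 + 2 * harm r else frac s + 2 * harm n)" for r :: nat
    have b: "0 \<le> b r" for r by (simp add: b_def harm_nonneg)
    have split: "?L (Suc k) s (case_nat u U) = ennreal \<bar>frac s - frac (s * (1 - u))\<bar> + ?L k (s * (1 - u)) U" for u U
      by (subst sum.lessThan_Suc_shift) (simp add: rest_case_nat mult.assoc)
    have step: "(\<integral>\<^sup>+U. ?L (Suc k) s (case_nat u U) \<partial>SU) \<le> ennreal (b (nat \<lfloor>s * (1 - u)\<rfloor>))"
      if u: "u \<in> {0..1}" for u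
    proof -
      let ?y = "s * (1 - u)"
      have y: "0 \<le> ?y" "?y \<le> s" using u s by (simp_all add: mult_left_le)
      have "(\<integral>\<^sup>+U. ?L (Suc k) s (case_nat u U) \<partial>SU) =
          ennreal \<bar>frac s - frac ?y\<bar> + (\<integral>\<^sup>+U. ?L k ?y U \<partial>SU)"
        unfolding split using S.emeasure_space_1 by (subst nn_integral_add) auto
      also have "\<dots> \<le> ennreal \<bar>frac s - frac ?y\<bar> + ennreal (frac ?y + 2 * harm (nat \<lfloor>?y\<rfloor>))"
        by (intro add_left_mono Suc.IH y)
      also have "\<dots> = ennreal (\<bar>frac s - frac ?y\<bar> + frac ?y + 2 * harm (nat \<lfloor>?y\<rfloor>))"
        by (subst ennreal_plus[symmetric]) (simp_all add: harm_nonneg add.assoc)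
      also have "\<bar>frac s - frac ?y\<bar> + frac ?y + 2 * harm (nat \<lfloor>?y\<rfloor>) \<le> b (nat \<lfloor>?y\<rfloor>)"
      proof (cases "nat \<lfloor>?y\<rfloor> < n")
        case True
        have "\<bar>p - q\<bar> + q \<le> p + 2" if "0 \<le> p" "p < 1" "0 \<le> q" "q < 1" for p q :: real
          using that by linarith
        from this[OF frac_ge_0 frac_lt_1 frac_ge_0 frac_lt_1, of s ?y]
        show ?thesis using True by (simp add: b_def)
      next
        case False
        then have e: "nat \<lfloor>?y\<rfloor> = n" using floor_cell(1)[OF n s u] by simp
        then have "frac ?y = ?y - real n" using y(1) unfolding frac_def by linarith
        then have "frac ?y \<le> frac s" using fr y by simp
        then show ?thesis using e by (simp add: b_def)
      qed
      finally show ?thesis by (simp add: ennreal_leI)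
    qed
    have "(\<integral>\<^sup>+U. ?L (Suc k) s U \<partial>SU) = (\<integral>\<^sup>+u. \<integral>\<^sup>+U. ?L (Suc k) s (case_nat u U) \<partial>SU \<partial>U01)"
      by (rule nn_integral_sequence_split[OF prob_space_U01]) measurable
    also have "\<dots> \<le> ennreal (((\<Sum>r<n. b r) + (s - real n) * b n) / s)"
      by (rule nn_integral_cells_le[where a=b, OF n s]) (rule b, rule step)
    also have "(\<Sum>r<n. b r) = (\<Sum>r<n. frac s + 2 + 2 * harm r)"
      by (simp add: b_def)
    also have "\<dots> = real n * (frac s + 2 * harm n)"
      unfolding sum.distrib sum_distrib_left[symmetric] sum_harm by (simp add: algebra_simps)
    \<comment> \<open>The average over the lower cells equals the value at the current cell, so the
      total weight \<open>s\<close> cancels.\<close>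
    also have "(real n * (frac s + 2 * harm n) + (s - real n) * b n) / s = frac s + 2 * harm n"
      using s by (simp add: b_def field_simps)
    finally show ?thesis by (simp add: n_def)
  qed
qed

section \<open>Level counts of families with two indices\<close>

lemma emeasure_count_space_image:
  assumes "inj f"
  shows "emeasure (count_space UNIV) (f ` A) = emeasure (count_space UNIV) A"
proof (cases "finite A")
  case True
  then show ?thesis using assms by (simp add: card_image inj_on_subset)
next
  case False
  then have "infinite (f ` A)" using assms by (metis finite_imageD inj_on_subset subset_UNIV)
  then show ?thesis using False by simp
qed

lemma lcount_case_row:
  fixes x :: "nat \<times> nat \<Rightarrow> real"
  shows "lcount x t = lcount (\<lambda>j. x (0, j)) t + lcount (\<lambda>(i, j). x (Suc i, j)) t"
proof -
  have "{p. t < x p} = Pair 0 ` {j. t < x (0, j)} \<union> (\<lambda>(i, j). (Suc i, j)) ` {p. t < (case p of (i, j) \<Rightarrow> x (Suc i, j))}"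
    (is "_ = ?A \<union> ?B")
  proof (intro equalityI subsetI)
    fix p assume p: "p \<in> {p. t < x p}"
    obtain i j where ij: "p = (i, j)" by force
    show "p \<in> ?A \<union> ?B"
    proof (cases i)
      case 0
      then show ?thesis using p ij by auto
    next
      case (Suc i')
      then have "(\<lambda>(i, j). (Suc i, j)) (i', j) \<in> ?B" using p ij by (intro imageI) auto
      then show ?thesis using Suc ij by auto
    qed
  qed auto
  then have "lcount x t = emeasure (count_space UNIV) ?A + emeasure (count_space UNIV) ?B"
    unfolding lcount_def by (subst plus_emeasure) auto
  then show ?thesis
    by (simp add: lcount_def emeasure_count_space_image inj_def split_beta prod_eq_iff)
qed

text \<open>As a countable sum of indicators the count is visibly measurable in any parameters of
  the family.\<close>

lemma lcount_prod_eq_suminf: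
  fixes x :: "nat \<times> nat \<Rightarrow> real"
  shows "lcount x t = (\<Sum>i. \<Sum>j. of_bool (t < x (i, j)))"
  unfolding lcount_def
  by (simp add: nn_integral_of_bool[symmetric] nn_integral_fst_count_space[symmetric] nn_integral_count_space_nat)

text \<open>Cycle partitions are indexed by sets of points, an uncountable type, so the finite
  support is first enumerated by naturals. The sum of the sorted entries is then the
  \<open>rho_1\<close> distance to the zero family, and \<open>desc_rearr_dist_sum\<close>
  applies.\<close>

lemma desc_rearr_suminf_le:
  assumes fin: "finite O'" and out: "\<And>Z. Z \<notin> O' \<Longrightarrow> x Z = 0" and nn: "\<And>Z. 0 \<le> x Z"
  shows "(\<Sum>k. ennreal (desc_rearr x k)) \<le> ennreal (sum x O')"
proof -
  let ?n = "card O'"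
  obtain f where f: "bij_betw f {0..<?n} O'" using ex_bij_betw_nat_finite[OF fin] by blast
  define y where "y i = (if i < ?n then x (f i) else 0)" for i :: nat
  have y: "0 \<le> y i" "y i \<le> sum x O'" for i
  proof -
    show "0 \<le> y i" by (simp add: y_def nn)
    have "x (f i) \<le> sum x O'" if "i < ?n"
      using f that fin nn by (intro member_le_sum) (auto dest: bij_betw_apply)
    then show "y i \<le> sum x O'" using nn by (auto simp: y_def sum_nonneg)
  qed
  have "lcount x t = lcount y t" if t: "0 \<le> t" for t
  proof -
    have "{Z. t < x Z} = f ` {i. t < y i}"
    proof (intro equalityI subsetI)
      fix Z assume Z: "Z \<in> {Z. t < x Z}"
      then have "Z \<in> O'" using out[of Z] t by fastforce
      then have "Z \<in> f ` {0..<?n}" using f by (simp add: bij_betw_def)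
      then obtain i where "i < ?n" "f i = Z" by auto
      then show "Z \<in> f ` {i. t < y i}" using Z by (auto simp: y_def intro!: image_eqI)
    qed (use t in \<open>auto simp: y_def split: if_splits\<close>)
    moreover have sub: "{i. t < y i} \<subseteq> {0..<?n}" using t by (auto simp: y_def split: if_splits)
    moreover have "inj_on f {i. t < y i}" using f sub by (auto simp: bij_betw_def intro: inj_on_subset)
    moreover have "finite {i. t < y i}" using sub finite_subset by blast
    ultimately show ?thesis by (simp add: lcount_def card_image)
  qed
  then have "desc_rearr x = desc_rearr y"
    unfolding desc_rearr_eq_rearr by (rule rearr_cong)
  then have "(\<Sum>k. ennreal (desc_rearr x k)) = rho_1 (desc_rearr y) (desc_rearr (\<lambda>_::nat. 0))"
    by (simp add: rho_1_def desc_rearr_zero abs_of_nonneg[OF desc_rearr_nonneg[OF y(2)]])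
  also have "\<dots> \<le> (\<integral>\<^sup>+i. ennreal \<bar>y i - 0\<bar> \<partial>count_space UNIV)"
    by (rule desc_rearr_dist_sum[of y "sum x O'"]) (use y nn in \<open>auto intro: sum_nonneg\<close>)
  also have "\<dots> = (\<integral>\<^sup>+i. ennreal (y i) * indicator {0..<?n} i \<partial>count_space UNIV)"
    by (intro nn_integral_cong) (auto simp: y_def nn)
  also have "\<dots> = (\<Sum>i\<in>{0..<?n}. ennreal (y i))"
    by (subst nn_integral_count_space_indicator[symmetric]) (auto simp: nn_integral_count_space_finite)
  also have "\<dots> = ennreal (\<Sum>i\<in>{0..<?n}. x (f i))"
    using nn by (subst sum_ennreal) (auto simp: y_def)
  also have "(\<Sum>i\<in>{0..<?n}. x (f i)) = sum x O'"
    by (rule sum.reindex_bij_betw[OF f])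
  finally show ?thesis .
qed

section \<open>The cycle partition of one permutation\<close>

context
  fixes N :: nat and \<sigma> :: "nat \<Rightarrow> nat"
  assumes \<sigma>: "\<sigma> permutes {1..N}"
begin

lemma orbit_subset_interval: "x \<in> {1..N} \<Longrightarrow> orbit \<sigma> x \<subseteq> {1..N}"
  using permutes_orbit_subset[OF \<sigma>] .

lemma orbits_eq_image: "{orbit \<sigma> x | x. x \<in> {1..N}} = orbit \<sigma> ` {1..N}"
  by auto

lemma card_orbit_le: "Z \<in> orbit \<sigma> ` {1..N} \<Longrightarrow> card Z \<le> N"
  using orbit_subset_interval card_mono[of "{1..N}" Z] by fastforce

text \<open>Translates between the two sides: sticks scale a sorted partition by
  \<open>\<kappa>\<close>, while block permutations put the factor into the weights of the
  points.\<close>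

lemma lcount_cycle_partition:
  assumes t: "0 \<le> t" and \<kappa>: "0 \<le> \<kappa>"
  shows "lcount (\<lambda>j. \<kappa> * cycle_partition N \<sigma> j) t = ocount \<sigma> {1..N} (\<lambda>_. \<kappa> / real N) t"
proof (cases "\<kappa> = 0")
  case True
  then show ?thesis using t by (simp add: lcount_def ocount_def)
next
  case False
  then have k: "0 < \<kappa>" using \<kappa> by simp
  let ?x = "\<lambda>Z. if Z \<in> {orbit \<sigma> x | x. x \<in> {1..N}} then real (card Z) / real N else 0"
  have b: "?x Z \<le> 1" for Z
    using card_orbit_le[of Z] unfolding orbits_eq_image by (auto simp: divide_le_eq_1)
  have "lcount (\<lambda>j. \<kappa> * cycle_partition N \<sigma> j) t = lcount (desc_rearr ?x) (t / \<kappa>)"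
    using k by (simp add: lcount_def cycle_partition_def divide_less_eq mult.commute)
  also have "\<dots> = lcount ?x (t / \<kappa>)"
    by (rule lcount_desc_rearr[OF _ b]) (use t k in simp)
  also have "\<dots> = emeasure (count_space UNIV) {Z \<in> orbit \<sigma> ` {1..N}. t < (\<Sum>_\<in>Z. \<kappa> / real N)}"
  proof -
    have "t / \<kappa> < ?x Z \<longleftrightarrow> Z \<in> orbit \<sigma> ` {1..N} \<and> t < (\<Sum>_\<in>Z. \<kappa> / real N)" for Z
      unfolding orbits_eq_image using t k by (auto simp: divide_less_eq mult.commute not_less split: if_splits)
    then show ?thesis by (simp add: lcount_def)
  qed
  also have "\<dots> = ocount \<sigma> {1..N} (\<lambda>_. \<kappa> / real N) t"
    by (simp add: ocount_def)
  finally show ?thesis .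
qed

text \<open>Distinct orbits are disjoint subsets of \<open>{1..N}\<close>. In the summed distance
  this bounds the cost of all parts of one stick by the displacement of the stick.\<close>

lemma suminf_cycle_partition_le: "(\<Sum>j. ennreal (cycle_partition N \<sigma> j)) \<le> 1"
proof -
  let ?O = "orbit \<sigma> ` {1..N}"
  let ?x = "\<lambda>Z. if Z \<in> ?O then real (card Z) / real N else 0"
  have perm: "permutation \<sigma>" using \<sigma> by (auto simp: permutation_permutes)
  have "pairwise disjnt ?O"
  proof (clarsimp simp: pairwise_def disjnt_def simp del: One_nat_def)
    fix x y assume ne: "orbit \<sigma> x \<noteq> orbit \<sigma> y"
    show "orbit \<sigma> x \<inter> orbit \<sigma> y = {}"
    proof (rule ccontr)
      assume "orbit \<sigma> x \<inter> orbit \<sigma> y \<noteq> {}"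
      then obtain z where "z \<in> orbit \<sigma> x" "z \<in> orbit \<sigma> y" by auto
      then show False using ne orbit_cyclic_eq3[OF cyclic_on_orbit'[OF perm]] by metis
    qed
  qed
  then have "(\<Sum>Z\<in>?O. card Z) = card (\<Union>?O)"
    using finite_subset[OF orbit_subset_interval finite_atLeastAtMost]
    by (intro card_Union_disjoint[symmetric]) blast+
  also have "\<dots> \<le> card {1..N}"
    by (intro card_mono finite_atLeastAtMost UN_least orbit_subset_interval)
  finally have "(\<Sum>Z\<in>?O. real (card Z)) \<le> real N" by (simp flip: of_nat_sum)
  moreover have "(\<Sum>Z\<in>?O. ?x Z) = (\<Sum>Z\<in>?O. real (card Z)) / real N"
    by (simp add: sum_divide_distrib)
  ultimately have "(\<Sum>Z\<in>?O. ?x Z) \<le> 1" by (auto simp: divide_le_eq_1)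
  moreover have "(\<Sum>j. ennreal (cycle_partition N \<sigma> j)) \<le> ennreal (\<Sum>Z\<in>?O. ?x Z)"
    unfolding cycle_partition_def orbits_eq_image by (rule desc_rearr_suminf_le) auto
  ultimately show ?thesis
    unfolding ennreal_1[symmetric] by (blast intro: order.trans ennreal_leI)
qed

lemma cycle_partition_nonneg: "0 \<le> cycle_partition N \<sigma> j"
  unfolding cycle_partition_def orbits_eq_image
  by (rule desc_rearr_nonneg[where b=1]) (use card_orbit_le in \<open>auto simp: divide_le_eq_1\<close>)

end

section \<open>The random inputs and the rounded family\<close>

lemma space_seqM [simp]: "space seqM = UNIV"
  by (simp add: seqM_def space_PiM)

lemma measurable_seqM_component [measurable]: "(\<lambda>b. b j) \<in> borel_measurable seqM"
  unfolding seqM_def by measurable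

lemma sets_lawB [measurable_cong, simp]: "sets (lawB m \<Gamma>) = sets seqM"
  by (simp add: lawB_def)

lemma space_lawB [simp]: "space (lawB m \<Gamma>) = UNIV"
  by (simp add: lawB_def)

lemma measurable_pmf_seqM: "(\<lambda>x. x) \<in> measurable (measure_pmf p) seqM"
  by (rule measurableI) simp_all

lemma prob_space_lawB: "prob_space (lawB m \<Gamma>)"
  unfolding lawB_def by (rule measure_pmf.prob_space_distr) (rule measurable_pmf_seqM)

abbreviation SB :: "nat \<Rightarrow> (nat \<Rightarrow> nat) set \<Rightarrow> (nat \<Rightarrow> nat \<Rightarrow> real) measure" where
  "SB m \<Gamma> \<equiv> PiM UNIV (\<lambda>_. lawB m \<Gamma>)"

lemma measurable_SB_component [measurable]: "(\<lambda>B. B i j) \<in> borel_measurable (SB m \<Gamma>)"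
proof -
  have "(\<lambda>B. B i) \<in> measurable (SB m \<Gamma>) (lawB m \<Gamma>)" by (rule measurable_component_singleton) simp
  moreover have "(\<lambda>b. b j) \<in> borel_measurable (lawB m \<Gamma>)"
    by (simp add: measurable_cong_sets[OF sets_lawB refl] measurable_seqM_component)
  ultimately show ?thesis by (rule measurable_compose)
qed

lemma nn_integral_lawB:
  assumes fin: "finite \<Gamma>" "\<Gamma> \<noteq> {}" and h [measurable]: "h \<in> borel_measurable seqM"
  shows "(\<integral>\<^sup>+b. h b \<partial>lawB m \<Gamma>) = (\<Sum>\<gamma>\<in>\<Gamma>. h (cycle_partition m \<gamma>)) / of_nat (card \<Gamma>)"
  unfolding lawB_def
  by (subst nn_integral_distr[OF measurable_pmf_seqM])
    (simp_all add: nn_integral_pmf_of_set[OF fin(2,1)])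

text \<open>For breaks in the unit interval this is the number of integers in
  \<open>(s * rest U (Suc i), s * rest U i]\<close>. The start \<open>s\<close> is real because the
  recursion replaces it by \<open>s * (1 - u)\<close>.\<close>

definition block_len :: "real \<Rightarrow> (nat \<Rightarrow> real) \<Rightarrow> nat \<Rightarrow> real" where
  "block_len s U i = of_int (\<lfloor>s * rest U i\<rfloor> - \<lfloor>s * rest U (Suc i)\<rfloor>)"

text \<open>The rounded family has \<open>\<kappa> = 1 / n\<close> and \<open>s = n\<close>. The two
  are kept apart since the recursion changes \<open>s\<close> but not the mesh.\<close>

definition fam :: "real \<Rightarrow> real \<Rightarrow> (nat \<Rightarrow> real) \<Rightarrow> (nat \<Rightarrow> nat \<Rightarrow> real) \<Rightarrow> nat \<times> nat \<Rightarrow> real" where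
  "fam \<kappa> s U B = (\<lambda>(i, j). \<kappa> * block_len s U i * B i j)"

lemma lcount_fam_split:
  "lcount (fam \<kappa> s (case_nat u U) (case_nat b B)) t =
    lcount (\<lambda>j. \<kappa> * of_int (\<lfloor>s\<rfloor> - \<lfloor>s * (1 - u)\<rfloor>) * b j) t + lcount (fam \<kappa> (s * (1 - u)) U B) t"
proof -
  have 0: "block_len s (case_nat u U) 0 = of_int (\<lfloor>s\<rfloor> - \<lfloor>s * (1 - u)\<rfloor>)"
    by (simp add: block_len_def rest_case_nat)
  have S: "block_len s (case_nat u U) (Suc i) = block_len (s * (1 - u)) U i" for i
    by (simp add: block_len_def rest_case_nat mult.assoc)
  have "lcount (fam \<kappa> s (case_nat u U) (case_nat b B)) t =
      lcount (\<lambda>j. fam \<kappa> s (case_nat u U) (case_nat b B) (0, j)) t +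
      lcount (\<lambda>(i, j). fam \<kappa> s (case_nat u U) (case_nat b B) (Suc i, j)) t"
    by (rule lcount_case_row)
  then show ?thesis
    unfolding fam_def by (simp only: prod.case 0 S nat.case)
qed

lemma measurable_lcount_fam [measurable]:
  "(\<lambda>(U, B). lcount (fam \<kappa> s U B) t) \<in> borel_measurable (SU \<Otimes>\<^sub>M SB m \<Gamma>)"
  unfolding lcount_prod_eq_suminf fam_def block_len_def of_bool_def by measurable

text \<open>Brings the first break and its copy of \<open>lawB\<close> outside; exchanging
  \<open>b\<close> with the later breaks is Fubini.\<close>

lemma nn_integral_head_split:
  assumes f [measurable]: "(\<lambda>(U, B). f U B) \<in> borel_measurable (SU \<Otimes>\<^sub>M SB m \<Gamma>)"
  shows "(\<integral>\<^sup>+U. \<integral>\<^sup>+B. f U B \<partial>SB m \<Gamma> \<partial>SU) =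
    (\<integral>\<^sup>+u. \<integral>\<^sup>+b. \<integral>\<^sup>+U. \<integral>\<^sup>+B. f (case_nat u U) (case_nat b B) \<partial>SB m \<Gamma> \<partial>SU \<partial>lawB m \<Gamma> \<partial>U01)"
proof -
  interpret U1: prob_space U01 by (rule prob_space_U01)
  interpret B1: prob_space "lawB m \<Gamma>" by (rule prob_space_lawB)
  interpret U: prob_space SU by (rule prob_space_PiM) (rule prob_space_U01)
  interpret B: prob_space "SB m \<Gamma>" by (rule prob_space_PiM) (rule prob_space_lawB)
  interpret P: pair_sigma_finite "lawB m \<Gamma>" SU ..
  have "(\<integral>\<^sup>+U. \<integral>\<^sup>+B. f U B \<partial>SB m \<Gamma> \<partial>SU) = (\<integral>\<^sup>+u. \<integral>\<^sup>+U. \<integral>\<^sup>+B. f (case_nat u U) B \<partial>SB m \<Gamma> \<partial>SU \<partial>U01)"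
    by (rule nn_integral_sequence_split[OF prob_space_U01]) measurable
  also have "\<dots> = (\<integral>\<^sup>+u. \<integral>\<^sup>+U. \<integral>\<^sup>+b. \<integral>\<^sup>+B. f (case_nat u U) (case_nat b B) \<partial>SB m \<Gamma> \<partial>lawB m \<Gamma> \<partial>SU \<partial>U01)"
  proof (intro nn_integral_cong nn_integral_sequence_split[OF prob_space_lawB])
    fix u :: real and U :: "nat \<Rightarrow> real"
    have "case_nat u U \<in> space SU" by (auto simp: space_PiM)
    then show "(\<lambda>B. f (case_nat u U) B) \<in> borel_measurable (SB m \<Gamma>)" by measurable
  qed
  also have "\<dots> = (\<integral>\<^sup>+u. \<integral>\<^sup>+b. \<integral>\<^sup>+U. \<integral>\<^sup>+B. f (case_nat u U) (case_nat b B) \<partial>SB m \<Gamma> \<partial>SU \<partial>lawB m \<Gamma> \<partial>U01)"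
  proof (intro nn_integral_cong P.Fubini')
    fix u :: real
    assume [measurable]: "u \<in> space U01"
    show "(\<lambda>(b, U). \<integral>\<^sup>+B. f (case_nat u U) (case_nat b B) \<partial>SB m \<Gamma>) \<in> borel_measurable (lawB m \<Gamma> \<Otimes>\<^sub>M SU)"
      by measurable
  qed
  finally show ?thesis .
qed

context finite_perm_group
begin

abbreviation test :: "(nat \<Rightarrow> real) set \<Rightarrow> (real \<Rightarrow> ennreal) \<Rightarrow> real" where
  "test S \<equiv> \<lambda>c. indicator S (rearr c)"

lemma bval_bounds: "0 \<le> bval \<kappa> (test S) n c" "bval \<kappa> (test S) n c \<le> 1"
proof (induction n arbitrary: c rule: less_induct)
  case (less n)
  {
    case 1
    show ?case using less by (cases n) (auto intro!: divide_nonneg_nonneg sum_nonneg)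
  next
    case 2
    show ?case
    proof (cases n)
      case (Suc n')
      have "(\<Sum>r\<le>n'. \<Sum>\<gamma>\<in>\<Gamma>. bval \<kappa> (test S) r (\<lambda>t. c t + ocount \<gamma> X (\<lambda>_. real (Suc n' - r) * \<kappa>) t))
        \<le> (\<Sum>r\<le>n'. \<Sum>\<gamma>\<in>\<Gamma>. 1)"
        using less Suc by (intro sum_mono) auto
      also have "\<dots> = real (Suc n') * real (card \<Gamma>)" by simp
      finally show ?thesis using Suc card_group_pos by (simp add: divide_le_eq_1)
    qed (simp add: indicator_def)
  }
qed

end

section \<open>The law of the rounded family\<close>

locale perm_subgroup = finite_perm_group "{1..m}" \<Gamma> for m :: nat and \<Gamma> +
  assumes m_pos: "1 \<le> m"
begin

text \<open>The counterpart of \<open>bval\<close> on the stick side, for a real starting length and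
  the test set \<open>S\<close>.\<close>

definition val :: "real \<Rightarrow> (nat \<Rightarrow> real) set \<Rightarrow> real \<Rightarrow> (real \<Rightarrow> ennreal) \<Rightarrow> ennreal" where
  "val \<kappa> S s c = (\<integral>\<^sup>+U. \<integral>\<^sup>+B. indicator S (rearr (\<lambda>t. c t + lcount (fam \<kappa> s U B) t)) \<partial>SB m \<Gamma> \<partial>SU)"

lemma val_cong:
  assumes "\<And>t. 0 \<le> t \<Longrightarrow> c t = c' t"
  shows "val \<kappa> S s c = val \<kappa> S s c'"
proof -
  have "rearr (\<lambda>t. c t + lcount (fam \<kappa> s U B) t) = rearr (\<lambda>t. c' t + lcount (fam \<kappa> s U B) t)" for U B
    by (rule rearr_cong) (simp add: assms)
  then show ?thesis by (simp add: val_def)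
qed

lemma val_le_1: "val \<kappa> S s c \<le> 1"
proof -
  interpret U: prob_space SU by (rule prob_space_PiM) (rule prob_space_U01)
  interpret B: prob_space "SB m \<Gamma>" by (rule prob_space_PiM) (rule prob_space_lawB)
  have "val \<kappa> S s c \<le> (\<integral>\<^sup>+U. \<integral>\<^sup>+B. 1 \<partial>SB m \<Gamma> \<partial>SU)"
    unfolding val_def by (intro nn_integral_mono) (auto simp: indicator_def)
  then show ?thesis by (simp add: U.emeasure_space_1 B.emeasure_space_1)
qed

lemma antimono_add_lcount:
  assumes "antimono c"
  shows "antimono (\<lambda>t. c t + lcount x t)"
  using assms antimono_lcount[of x] by (auto simp: antimono_def intro!: add_mono)

lemma antimono_add_ocount:
  assumes "antimono c"
  shows "antimono (\<lambda>t. c t + ocount f {1..m} w t)"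
proof -
  have "antimono (ocount f {1..m} w)"
    by (auto simp: antimono_def ocount_def intro!: card_mono)
  then show ?thesis using assms by (auto simp: antimono_def intro!: add_mono)
qed

lemma measurable_val_integrand:
  assumes S: "S \<in> sets seqM" and c: "antimono c"
  shows "(\<lambda>(U, B). indicator S (rearr (\<lambda>t. c t + lcount (fam \<kappa> s U B) t)) :: ennreal)
    \<in> borel_measurable (SU \<Otimes>\<^sub>M SB m \<Gamma>)"
proof -
  have "(\<lambda>w. rearr (\<lambda>t. c t + lcount (fam \<kappa> s (fst w) (snd w)) t)) \<in> measurable (SU \<Otimes>\<^sub>M SB m \<Gamma>) seqM"
  proof (rule measurable_rearr)
    fix t
    have "(\<lambda>w. lcount (fam \<kappa> s (fst w) (snd w)) t) \<in> borel_measurable (SU \<Otimes>\<^sub>M SB m \<Gamma>)"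
      using measurable_lcount_fam[of \<kappa> s t m \<Gamma>] by (simp add: case_prod_beta)
    then show "(\<lambda>w. c t + lcount (fam \<kappa> s (fst w) (snd w)) t) \<in> borel_measurable (SU \<Otimes>\<^sub>M SB m \<Gamma>)"
      by measurable
  qed (rule antimono_add_lcount[OF c])
  moreover have "(indicator S :: _ \<Rightarrow> ennreal) \<in> borel_measurable seqM"
    using S by measurable
  ultimately show ?thesis
    unfolding case_prod_beta by (rule measurable_compose)
qed

text \<open>As \<open>lawB\<close> averages over \<open>\<Gamma>\<close>, conditioning on the first
  break gives the recursion of \<open>bval\<close>, except that the break may stay in its
  cell.\<close>

lemma val_rec:
  assumes S: "S \<in> sets seqM" and c: "antimono c"
  shows "val \<kappa> S s c = (\<integral>\<^sup>+u. (\<Sum>\<gamma>\<in>\<Gamma>. val \<kappa> S (s * (1 - u))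
    (\<lambda>t. c t + lcount (\<lambda>j. \<kappa> * of_int (\<lfloor>s\<rfloor> - \<lfloor>s * (1 - u)\<rfloor>) * cycle_partition m \<gamma> j) t)) / of_nat (card \<Gamma>) \<partial>U01)"
proof -
  interpret B: prob_space "SB m \<Gamma>" by (rule prob_space_PiM) (rule prob_space_lawB)
  interpret U: prob_space SU by (rule prob_space_PiM) (rule prob_space_U01)
  define f where "f U B = (indicator S (rearr (\<lambda>t. c t + lcount (fam \<kappa> s U B) t)) :: ennreal)" for U B
  have f [measurable]: "(\<lambda>(U, B). f U B) \<in> borel_measurable (SU \<Otimes>\<^sub>M SB m \<Gamma>)"
    unfolding f_def by (rule measurable_val_integrand[OF S c])
  have inner: "(\<integral>\<^sup>+U. \<integral>\<^sup>+B. f (case_nat u U) (case_nat b B) \<partial>SB m \<Gamma> \<partial>SU) =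
    val \<kappa> S (s * (1 - u)) (\<lambda>t. c t + lcount (\<lambda>j. \<kappa> * of_int (\<lfloor>s\<rfloor> - \<lfloor>s * (1 - u)\<rfloor>) * b j) t)" for u b
    unfolding f_def val_def lcount_fam_split by (simp add: add.assoc)
  have "val \<kappa> S s c = (\<integral>\<^sup>+U. \<integral>\<^sup>+B. f U B \<partial>SB m \<Gamma> \<partial>SU)"
    by (simp add: val_def f_def)
  also have "\<dots> = (\<integral>\<^sup>+u. \<integral>\<^sup>+b. \<integral>\<^sup>+U. \<integral>\<^sup>+B. f (case_nat u U) (case_nat b B) \<partial>SB m \<Gamma> \<partial>SU \<partial>lawB m \<Gamma> \<partial>U01)"
    by (rule nn_integral_head_split[OF f])
  also have "\<dots> = (\<integral>\<^sup>+u. (\<Sum>\<gamma>\<in>\<Gamma>. \<integral>\<^sup>+U. \<integral>\<^sup>+B. f (case_nat u U) (case_nat (cycle_partition m \<gamma>) B) \<partial>SB m \<Gamma> \<partial>SU)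
      / of_nat (card \<Gamma>) \<partial>U01)"
  proof (intro nn_integral_cong nn_integral_lawB finite_group nonempty)
    fix u :: real
    assume [measurable]: "u \<in> space U01"
    have "(\<lambda>b. \<integral>\<^sup>+U. \<integral>\<^sup>+B. f (case_nat u U) (case_nat b B) \<partial>SB m \<Gamma> \<partial>SU) \<in> borel_measurable (lawB m \<Gamma>)"
      by measurable
    then show "(\<lambda>b. \<integral>\<^sup>+U. \<integral>\<^sup>+B. f (case_nat u U) (case_nat b B) \<partial>SB m \<Gamma> \<partial>SU) \<in> borel_measurable seqM"
      by (simp add: measurable_cong_sets[OF sets_lawB refl])
  qed
  finally show ?thesis unfolding inner .
qed

text \<open>All floors vanish, so no part is added. This is the case \<open>n = 0\<close>, in which
  the weight \<open>(s - n) / s\<close> of the contraction would be 1.\<close>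

lemma val_below_1:
  assumes s: "0 \<le> s" "s < 1"
  shows "val \<kappa> S s c = ennreal (test S c)"
proof -
  interpret U: prob_space SU by (rule prob_space_PiM) (rule prob_space_U01)
  interpret B: prob_space "SB m \<Gamma>" by (rule prob_space_PiM) (rule prob_space_lawB)
  have "rearr (\<lambda>t. c t + lcount (fam \<kappa> s U B) t) = rearr c" if U: "\<forall>i. U i \<in> {0..1}" for U B
  proof (rule rearr_cong)
    fix t :: real assume t: "0 \<le> t"
    have "\<lfloor>s * rest U i\<rfloor> = 0" for i
    proof -
      have "0 \<le> rest U i" "rest U i \<le> 1" using rest_bounds[of U i] U by auto
      then have "0 \<le> s * rest U i" "s * rest U i \<le> s"
        using s by (simp_all add: mult_left_le)
      then show ?thesis using s by (intro floor_unique) auto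
    qed
    then have "fam \<kappa> s U B = (\<lambda>_. 0)" by (simp add: fam_def block_len_def fun_eq_iff)
    then show "c t + lcount (fam \<kappa> s U B) t = c t" using t by (simp add: lcount_def)
  qed
  then have "val \<kappa> S s c = (\<integral>\<^sup>+U. \<integral>\<^sup>+B. indicator S (rearr c) \<partial>SB m \<Gamma> \<partial>SU)"
    unfolding val_def by (intro nn_integral_cong_AE eventually_mono[OF AE_SU]) simp
  also have "\<dots> = indicator S (rearr c)"
    by (simp add: U.emeasure_space_1 B.emeasure_space_1)
  finally show ?thesis by (simp add: indicator_def)
qed

text \<open>Within one cell the error \<open>val - bval\<close> at \<open>s\<close> is an average of errors in the same cell
  with total weight \<open>(s - n) / s \<le> 1 / 2\<close>, so it vanishes.\<close>

lemma val_eq_bval: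
  assumes S: "S \<in> sets seqM" and \<kappa>: "0 < \<kappa>" and "antimono c" "real n \<le> s" "s < real n + 1"
  shows "val \<kappa> S s c = ennreal (bval (\<kappa> / real m) (test S) n c)"
  using assms(3-5)
proof (induction n arbitrary: s c rule: less_induct)
  case (less n)
  note One_nat_def [simp del]
  note c = less.prems(1)
  let ?b = "bval (\<kappa> / real m) (test S)"
  let ?o = "\<lambda>\<gamma> k. ocount \<gamma> {1..m} (\<lambda>_. real k * (\<kappa> / real m))"
  show ?case
  proof (cases n)
    case 0
    then show ?thesis using val_below_1 less.prems by simp
  next
    case (Suc n')
    then have n1: "1 \<le> real n" by simp
    define G where "G = real (card \<Gamma>)"
    have G: "0 < G" using card_group_pos by (simp add: G_def)
    define V where "V = ?b n c"
    have V: "0 \<le> V" "V \<le> 1" using bval_bounds by (simp_all add: V_def)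
    \<comment> \<open>The value after a jump to a lower cell \<open>r\<close>, known exactly by
      induction; the recursion of \<open>bval\<close> says that its mean over \<open>r < n\<close>
      is \<open>V\<close>.\<close>
    define a where "a r = (\<Sum>\<gamma>\<in>\<Gamma>. ?b r (\<lambda>t. c t + ?o \<gamma> (n - r) t)) / G" for r
    have a0: "0 \<le> a r" for r
      using G bval_bounds(1) by (auto simp: a_def intro!: divide_nonneg_nonneg sum_nonneg)
    have suma: "(\<Sum>r<n. a r) = real n * V"
      using G unfolding V_def a_def Suc by (simp add: lessThan_Suc_atMost sum_divide_distrib[symmetric] G_def)
    define I where "I s u = (\<Sum>\<gamma>\<in>\<Gamma>. val \<kappa> S (s * (1 - u))
      (\<lambda>t. c t + lcount (\<lambda>j. \<kappa> * of_int (\<lfloor>s\<rfloor> - \<lfloor>s * (1 - u)\<rfloor>) * cycle_partition m \<gamma> j) t)) / of_nat (card \<Gamma>)"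
      for s u
    have rec: "val \<kappa> S s c = (\<integral>\<^sup>+u. I s u \<partial>U01)" for s
      unfolding I_def by (rule val_rec[OF S c])
    have fl: "nat \<lfloor>s * (1 - u)\<rfloor> \<le> n \<and> 0 \<le> s * (1 - u) \<and>
        of_int (\<lfloor>s\<rfloor> - \<lfloor>s * (1 - u)\<rfloor>) = real (n - nat \<lfloor>s * (1 - u)\<rfloor>)"
      if s: "real n \<le> s" "s < real n + 1" and u: "u \<in> {0..1}" for s u
    proof -
      have s0: "0 < s" using s n1 by linarith
      have y: "0 \<le> s * (1 - u)" using u s0 by simp
      have "nat \<lfloor>s * (1 - u)\<rfloor> \<le> n" by (rule floor_cell(1)[OF s s0 u])
      moreover have "\<lfloor>s\<rfloor> = int n" using s by (intro floor_unique) auto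
      moreover have "0 \<le> \<lfloor>s * (1 - u)\<rfloor>" using y by simp
      ultimately show ?thesis using y by (simp add: of_nat_diff)
    qed
    have I_less: "I s u = ennreal (a (nat \<lfloor>s * (1 - u)\<rfloor>))"
      if s: "real n \<le> s" "s < real n + 1" and u: "u \<in> {0..1}" and r: "nat \<lfloor>s * (1 - u)\<rfloor> < n" for s u
    proof -
      let ?y = "s * (1 - u)"
      let ?r = "nat \<lfloor>?y\<rfloor>"
      have y: "0 \<le> ?y" using fl[OF s u] by simp
      then have cell: "real ?r \<le> ?y" "?y < real ?r + 1" by simp_all
      have "val \<kappa> S ?y (\<lambda>t. c t + lcount (\<lambda>j. \<kappa> * of_int (\<lfloor>s\<rfloor> - \<lfloor>?y\<rfloor>) * cycle_partition m \<gamma> j) t) =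
          ennreal (?b ?r (\<lambda>t. c t + ?o \<gamma> (n - ?r) t))" if \<gamma>: "\<gamma> \<in> \<Gamma>" for \<gamma>
      proof -
        have "lcount (\<lambda>j. \<kappa> * of_int (\<lfloor>s\<rfloor> - \<lfloor>?y\<rfloor>) * cycle_partition m \<gamma> j) t = ?o \<gamma> (n - ?r) t"
          if "0 \<le> t" for t
          using lcount_cycle_partition[OF perm[OF \<gamma>] that, of "\<kappa> * of_int (\<lfloor>s\<rfloor> - \<lfloor>?y\<rfloor>)"] \<kappa> fl[OF s u]
          by (simp add: mult.commute)
        then have "val \<kappa> S ?y (\<lambda>t. c t + lcount (\<lambda>j. \<kappa> * of_int (\<lfloor>s\<rfloor> - \<lfloor>?y\<rfloor>) * cycle_partition m \<gamma> j) t) =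
            val \<kappa> S ?y (\<lambda>t. c t + ?o \<gamma> (n - ?r) t)"
          by (intro val_cong) simp
        also have "\<dots> = ennreal (?b ?r (\<lambda>t. c t + ?o \<gamma> (n - ?r) t))"
          by (rule less.IH[OF r antimono_add_ocount[OF c] cell])
        finally show ?thesis .
      qed
      then have "I s u = (\<Sum>\<gamma>\<in>\<Gamma>. ennreal (?b ?r (\<lambda>t. c t + ?o \<gamma> (n - ?r) t))) / of_nat (card \<Gamma>)"
        by (simp add: I_def)
      also have "\<dots> = ennreal (a ?r)"
        using G bval_bounds(1) unfolding a_def G_def
        by (simp add: sum_nonneg ennreal_of_nat_eq_real_of_nat divide_ennreal)
      finally show ?thesis .
    qed
    have I_eq: "I s u = val \<kappa> S (s * (1 - u)) c"
      if s: "real n \<le> s" "s < real n + 1" and u: "u \<in> {0..1}" and r: "nat \<lfloor>s * (1 - u)\<rfloor> = n" for s u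
    proof -
      let ?y = "s * (1 - u)"
      have "val \<kappa> S ?y (\<lambda>t. c t + lcount (\<lambda>j. \<kappa> * of_int (\<lfloor>s\<rfloor> - \<lfloor>?y\<rfloor>) * cycle_partition m \<gamma> j) t) = val \<kappa> S ?y c" for \<gamma>
        using fl[OF s u] r by (intro val_cong) (simp add: lcount_def)
      then have "I s u = (val \<kappa> S ?y c * of_nat (card \<Gamma>)) / of_nat (card \<Gamma>)"
        by (simp add: I_def mult.commute)
      also have "\<dots> = val \<kappa> S ?y c"
        using card_group_pos by (intro ennreal_mult_divide_eq) auto
      finally show ?thesis .
    qed
    have in_cell: "real n \<le> s * (1 - u) \<and> s * (1 - u) < real n + 1"
      if s: "real n \<le> s" "s < real n + 1" and u: "u \<in> {0..1}" and r: "nat \<lfloor>s * (1 - u)\<rfloor> = n" for s u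
      using fl[OF s u] r by linarith
    \<comment> \<open>The factor is at most one half because
      \<open>s < n + 1 \<le> 2 * n\<close>.\<close>
    have contract: "(real n * V + (s - real n) * (V + d)) / s = V + d * ((s - real n) / s)"
      and half: "0 \<le> (s - real n) / s" "(s - real n) / s \<le> 1 / 2"
      if s: "real n \<le> s" "s < real n + 1" for s d
      using s n1 by (simp_all add: field_simps)
    \<comment> \<open>The estimate must hold for all \<open>s\<close> of the cell at once, since a
      break inside the cell moves \<open>s\<close>. It starts from \<open>val_le_1\<close>.\<close>
    have upper: "val \<kappa> S s c \<le> ennreal (V + (1 / 2) ^ j)" if "real n \<le> s" "s < real n + 1" for s j
      using that
    proof (induction j arbitrary: s)
      case 0
      have "val \<kappa> S s c \<le> 1" by (rule val_le_1)
      also have "1 \<le> ennreal (V + (1 / 2) ^ 0)" using V by simp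
      finally show ?case .
    next
      case (Suc j)
      have s0: "0 < s" using Suc.prems n1 by linarith
      define a' where "a' r = (if r < n then a r else V + (1 / 2) ^ j)" for r
      have "I s u \<le> ennreal (a' (nat \<lfloor>s * (1 - u)\<rfloor>))" if u: "u \<in> {0..1}" for u
        using I_less[OF Suc.prems u] I_eq[OF Suc.prems u] fl[OF Suc.prems u]
          Suc.IH in_cell[OF Suc.prems u] by (cases "nat \<lfloor>s * (1 - u)\<rfloor> < n") (auto simp: a'_def)
      moreover have "0 \<le> a' r" for r using a0 V by (simp add: a'_def)
      ultimately have "val \<kappa> S s c \<le> ennreal (((\<Sum>r<n. a' r) + (s - real n) * a' n) / s)"
        unfolding rec by (intro nn_integral_cells_le[where a=a', OF Suc.prems s0])
      also have "((\<Sum>r<n. a' r) + (s - real n) * a' n) / s = V + (1 / 2) ^ j * ((s - real n) / s)"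
        using contract[OF Suc.prems] by (simp add: a'_def suma)
      also have "\<dots> \<le> V + (1 / 2) ^ j * (1 / 2)"
        by (intro add_left_mono mult_left_mono half(2)[OF Suc.prems]) simp
      finally show ?case by (simp add: ennreal_leI mult.commute)
    qed
    have lower: "ennreal (V - (1 / 2) ^ j) \<le> val \<kappa> S s c" if "real n \<le> s" "s < real n + 1" for s j
      using that
    proof (induction j arbitrary: s)
      case 0
      then show ?case using V by (simp add: ennreal_neg)
    next
      case (Suc j)
      have s0: "0 < s" using Suc.prems n1 by linarith
      \<comment> \<open>Cell values have to be nonnegative; truncating at 0 achieves this and is
        invisible after \<open>ennreal\<close>.\<close>
      define a' where "a' r = (if r < n then a r else max 0 (V - (1 / 2) ^ j))" for r
      have "ennreal (a' (nat \<lfloor>s * (1 - u)\<rfloor>)) \<le> I s u" if u: "u \<in> {0..1}" for u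
        using I_less[OF Suc.prems u] I_eq[OF Suc.prems u] fl[OF Suc.prems u]
          Suc.IH in_cell[OF Suc.prems u]
        by (cases "nat \<lfloor>s * (1 - u)\<rfloor> < n") (auto simp: a'_def max_def)
      moreover have "0 \<le> a' r" for r using a0 by (simp add: a'_def)
      ultimately have *: "ennreal (((\<Sum>r<n. a' r) + (s - real n) * a' n) / s) \<le> val \<kappa> S s c"
        unfolding rec by (intro nn_integral_cells_ge[where a=a', OF Suc.prems s0])
      have "V - (1 / 2) ^ Suc j = V + - ((1 / 2) ^ j * (1 / 2))" by simp
      also have "\<dots> \<le> V + - ((1 / 2) ^ j * ((s - real n) / s))"
        by (intro add_left_mono le_imp_neg_le mult_left_mono half(2)[OF Suc.prems]) simp
      also have "\<dots> = (real n * V + (s - real n) * (V - (1 / 2) ^ j)) / s"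
        using contract[OF Suc.prems, of "- ((1 / 2) ^ j)"] by simp
      also have "\<dots> \<le> ((\<Sum>r<n. a' r) + (s - real n) * a' n) / s"
        using Suc.prems s0 by (intro divide_right_mono) (auto simp: a'_def suma intro!: mult_left_mono)
      finally show ?case using * by (meson ennreal_leI order.trans)
    qed
    have lim: "(\<lambda>j. ennreal (V + (1 / 2) ^ j)) \<longlonglongrightarrow> ennreal (V + 0)"
        "(\<lambda>j. ennreal (V - (1 / 2) ^ j)) \<longlonglongrightarrow> ennreal (V - 0)"
      by (intro tendsto_ennrealI tendsto_intros LIMSEQ_power_zero; simp)+
    have "val \<kappa> S s c \<le> ennreal V"
      using LIMSEQ_le_const[OF lim(1), of "val \<kappa> S s c"] upper less.prems by auto
    moreover have "ennreal V \<le> val \<kappa> S s c"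
      using LIMSEQ_le_const2[OF lim(2), of "val \<kappa> S s c"] lower less.prems by auto
    ultimately show ?thesis by (simp add: V_def)
  qed
qed

end

section \<open>The coupling\<close>

lemma desc_rearr_idem:
  assumes "\<And>i. x i \<le> b"
  shows "desc_rearr (desc_rearr x) = desc_rearr x"
proof -
  have "desc_rearr (desc_rearr x) = rearr (lcount (desc_rearr x))" by (rule desc_rearr_eq_rearr)
  also have "\<dots> = rearr (lcount x)" by (rule rearr_cong) (rule lcount_desc_rearr[OF _ assms])
  finally show ?thesis by (simp only: desc_rearr_eq_rearr)
qed

lemma cycle_partition_eq_rearr:
  assumes "\<sigma> permutes {1..N}"
  shows "cycle_partition N \<sigma> = rearr (ocount \<sigma> {1..N} (\<lambda>_. 1 / real N))"
proof -
  have "cycle_partition N \<sigma> = desc_rearr (cycle_partition N \<sigma>)"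
    unfolding cycle_partition_def orbits_eq_image[OF assms]
    by (rule desc_rearr_idem[symmetric, where b=1])
       (use card_orbit_le[OF assms] in \<open>auto simp: divide_le_eq_1\<close>)
  also have "\<dots> = rearr (ocount \<sigma> {1..N} (\<lambda>_. 1 / real N))"
    unfolding desc_rearr_eq_rearr
    using lcount_cycle_partition[OF assms, of _ 1] by (intro rearr_cong) simp
  finally show ?thesis .
qed

section \<open>From blocks to the action on an interval, and the two marginals\<close>

context perm_subgroup
begin

lemma wreath_act_block:
  assumes i: "i \<in> {1..n}" and r: "r \<in> {1..m}"
  shows "wreath_act m n g h ((i - 1) * m + r) = (h i - 1) * m + g i r"
    and "(i - 1) * m + r \<in> {1..m * n}"
proof -
  obtain i' where i': "i = Suc i'" "i' < n" using i by (cases i) auto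
  obtain r' where r': "r = Suc r'" "r' < m" using r by (cases r) auto
  have "i' * m + r' < n * m"
  proof -
    have "i' * m + r' < Suc i' * m" using r'(2) by simp
    also have "\<dots> \<le> n * m" using i'(2) by (intro mult_le_mono1) simp
    finally show ?thesis .
  qed
  then show in_range: "(i - 1) * m + r \<in> {1..m * n}" using i' r' by (simp add: mult.commute)
  have "((i - 1) * m + r - 1) div m + 1 = i" "((i - 1) * m + r - 1) mod m + 1 = r"
    using i' r' by simp_all
  then show "wreath_act m n g h ((i - 1) * m + r) = (h i - 1) * m + g i r"
    unfolding wreath_act_def using in_range by (simp only: if_True Let_def)
qed

lemma bij_betw_blocks:
  "bij_betw (\<lambda>(i, r). (i - 1) * m + r) ({1..n} \<times> {1..m}) {1..m * n}"
proof (rule bij_betw_byWitness[where f'="\<lambda>x. ((x - 1) div m + 1, (x - 1) mod m + 1)"])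
  show "\<forall>a\<in>{1..n} \<times> {1..m}. (\<lambda>x. ((x - 1) div m + 1, (x - 1) mod m + 1)) ((\<lambda>(i, r). (i - 1) * m + r) a) = a"
  proof (clarsimp simp: less_eq_Suc_le[symmetric])
    fix i r assume "0 < i" "i \<le> n" "0 < r" "r \<le> m"
    then obtain i' r' where *: "i = Suc i'" "r = Suc r'" "r' < m"
      by (metis Suc_le_eq gr0_implies_Suc)
    show "Suc (((i - Suc 0) * m + r - Suc 0) div m) = i \<and> Suc (((i - Suc 0) * m + r - Suc 0) mod m) = r"
      using * by simp
  qed
  show "\<forall>x\<in>{1..m * n}. (\<lambda>(i, r). (i - 1) * m + r) ((x - 1) div m + 1, (x - 1) mod m + 1) = x"
    by auto
  show "(\<lambda>(i, r). (i - 1) * m + r) ` ({1..n} \<times> {1..m}) \<subseteq> {1..m * n}"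
    using wreath_act_block(2) by auto
  show "(\<lambda>x. ((x - 1) div m + 1, (x - 1) mod m + 1)) ` {1..m * n} \<subseteq> {1..n} \<times> {1..m}"
  proof (intro image_subsetI)
    fix x assume x: "x \<in> {1..m * n}"
    have "(x - 1) div m < n" using x m_pos by (intro div_less_iff_less_mult[THEN iffD2]) (auto simp: mult.commute)
    moreover have "(x - 1) mod m < m" using m_pos by simp
    ultimately show "((x - 1) div m + 1, (x - 1) mod m + 1) \<in> {1..n} \<times> {1..m}" by auto
  qed
qed

context
  fixes n :: nat and g :: "nat \<Rightarrow> nat \<Rightarrow> nat" and h :: "nat \<Rightarrow> nat"
  assumes g: "\<And>i. i \<in> {1..n} \<Longrightarrow> g i \<in> \<Gamma>" and h: "h permutes {1..n}"
begin

lemma wreath_act_conj: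
  assumes "x \<in> {1..n} \<times> {1..m}"
  shows "wreath_act m n g h ((\<lambda>(i, r). (i - 1) * m + r) x) = (\<lambda>(i, r). (i - 1) * m + r) (block_perm {1..n} g h x)"
proof -
  obtain i r where x: "x = (i, r)" "i \<in> {1..n}" "r \<in> {1..m}" using assms by auto
  then have "block_perm {1..n} g h (i, r) = (h i, g i r)"
    unfolding block_perm_def prod.case by (simp only: if_True simp_thms)
  then show ?thesis using wreath_act_block(1)[OF x(2,3)] by (simp only: x(1) prod.case)
qed

lemma block_perm_permutes': "block_perm {1..n} g h permutes ({1..n} \<times> {1..m})"
  by (rule block_perm_permutes) (use g h in auto)

lemma wreath_act_permutes: "wreath_act m n g h permutes {1..m * n}"
proof (rule bij_imp_permutes)
  let ?\<phi> = "\<lambda>(i, r). (i - 1) * m + r" and ?X = "{1..n} \<times> {1..m}"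
  have "bij_betw (?\<phi> \<circ> block_perm {1..n} g h) ?X {1..m * n}"
    by (rule bij_betw_trans[OF permutes_imp_bij[OF block_perm_permutes'] bij_betw_blocks])
  then have "bij_betw (wreath_act m n g h \<circ> ?\<phi>) ?X {1..m * n}"
    using wreath_act_conj by (subst bij_betw_cong) (auto simp: comp_def)
  then show "bij_betw (wreath_act m n g h) {1..m * n} {1..m * n}"
    using bij_betw_comp_iff[OF bij_betw_blocks] by blast
qed (auto simp: wreath_act_def)

lemma ocount_wreath_act:
  "ocount (wreath_act m n g h) {1..m * n} (\<lambda>_. w) = bcount {1..n} (\<lambda>_. w) g h"
proof (rule ext)
  fix t
  let ?\<phi> = "\<lambda>(i, r). (i - 1) * m + r" and ?X = "{1..n} \<times> {1..m}"
  have "ocount (wreath_act m n g h) (?\<phi> ` ?X) (\<lambda>_. w) t = ocount (block_perm {1..n} g h) ?X (\<lambda>_. w) t"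
    using bij_betw_blocks wreath_act_conj permutes_in_image[OF block_perm_permutes']
    by (intro ocount_transport) (blast intro: bij_betw_imp_inj_on)+
  then show "ocount (wreath_act m n g h) {1..m * n} (\<lambda>_. w) t = bcount {1..n} (\<lambda>_. w) g h t"
    unfolding bcount_def bij_betw_imp_surj_on[OF bij_betw_blocks] .
qed

end

text \<open>The mean over the wreath product is \<open>wsum\<close> divided by the order
  \<open>card \<Gamma> ^ n * fact n\<close>, which is exactly the prefactor in
  \<open>wsum_eq_bval\<close>.\<close>

lemma emeasure_lawC:
  assumes S: "S \<in> sets seqM" and n: "1 \<le> n"
  shows "emeasure (lawC m \<Gamma> n) S = ennreal (bval (1 / real (m * n)) (test S) n (\<lambda>_. 0))"
proof -
  let ?A = "PiE {1..n} (\<lambda>_. \<Gamma>) \<times> {h. h permutes {1..n}}"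
  let ?w = "1 / real (m * n)"
  have fin: "finite ?A" by (intro finite_cartesian_product finite_PiE finite_permutations) auto
  have ne: "?A \<noteq> {}"
  proof -
    have "{h. h permutes {1..n}} \<noteq> {}" using permutes_id by blast
    moreover have "PiE {1..n} (\<lambda>_. \<Gamma>) \<noteq> {}" using nonempty by (simp add: PiE_eq_empty_iff)
    ultimately show ?thesis by (simp only: Times_empty) blast
  qed
  have cardA: "real (card ?A) = real (card \<Gamma>) ^ n * fact n"
    by (simp add: card_cartesian_product card_PiE card_permutations)
  have cyc: "(indicator S (cycle_partition (m * n) (wreath_act m n g h)) :: real) =
      test S (\<lambda>t. 0 + bcount {1..n} (\<lambda>_. ?w) g h t)"
    if gh: "g \<in> PiE {1..n} (\<lambda>_. \<Gamma>)" "h permutes {1..n}" for g h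
  proof -
    have g: "g i \<in> \<Gamma>" if "i \<in> {1..n}" for i using gh(1) that by (auto simp: PiE_iff)
    have "wreath_act m n g h permutes {1..m * n}"
      by (rule wreath_act_permutes[OF _ gh(2)]) (rule g)
    then have "cycle_partition (m * n) (wreath_act m n g h) =
        rearr (ocount (wreath_act m n g h) {1..m * n} (\<lambda>_. ?w))"
      by (rule cycle_partition_eq_rearr)
    also have "ocount (wreath_act m n g h) {1..m * n} (\<lambda>_. ?w) = bcount {1..n} (\<lambda>_. ?w) g h"
      by (rule ocount_wreath_act[OF _ gh(2)]) (rule g)
    finally show ?thesis by simp
  qed
  let ?p = "map_pmf (\<lambda>(g, h). cycle_partition (m * n) (wreath_act m n g h)) (pmf_of_set ?A)"
  have "emeasure (lawC m \<Gamma> n) S = emeasure (measure_pmf ?p) S"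
    unfolding lawC_def
    by (subst emeasure_distr[OF measurable_pmf_seqM S]) (simp only: space_measure_pmf Int_UNIV_right vimage_ident)
  also have "\<dots> = (\<integral>\<^sup>+x. indicator S x \<partial>measure_pmf ?p)"
    by (rule nn_integral_indicator[symmetric]) simp
  also have "\<dots> = (\<integral>\<^sup>+x. indicator S (case x of (g, h) \<Rightarrow> cycle_partition (m * n) (wreath_act m n g h)) \<partial>measure_pmf (pmf_of_set ?A))"
    by (rule nn_integral_map_pmf)
  also have "\<dots> = (\<Sum>x\<in>?A. indicator S (case x of (g, h) \<Rightarrow> cycle_partition (m * n) (wreath_act m n g h))) / of_nat (card ?A)"
    by (rule nn_integral_pmf_of_set[OF ne fin])
  also have "\<dots> = ennreal ((\<Sum>x\<in>?A. indicator S (case x of (g, h) \<Rightarrow> cycle_partition (m * n) (wreath_act m n g h))) / real (card ?A))"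
    using fin ne card_gt_0_iff[of ?A]
    by (simp add: ennreal_of_nat_eq_real_of_nat sum_nonneg flip: divide_ennreal ennreal_indicator)
  also have "(\<Sum>x\<in>?A. indicator S (case x of (g, h) \<Rightarrow> cycle_partition (m * n) (wreath_act m n g h))) = wsum (test S) {1..n} (\<lambda>_. ?w) (\<lambda>_. 0)"
    unfolding wsum_def
    by (subst sum.cartesian_product) (auto intro!: sum.cong simp only: cyc prod.case mem_Sigma_iff mem_Collect_eq)
  also have "\<dots> / real (card ?A) = bval ?w (test S) n (\<lambda>_. 0)"
    using card_group_pos unfolding cardA by (subst wsum_eq_bval[of _ n]) auto
  finally show ?thesis .
qed

lemma measurable_desc_rearr_family:
  fixes X :: "'w \<Rightarrow> nat \<times> nat \<Rightarrow> real"
  assumes [measurable]: "\<And>i j. (\<lambda>w. X w (i, j)) \<in> borel_measurable M"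
  shows "(\<lambda>w. desc_rearr (X w)) \<in> measurable M seqM"
  unfolding desc_rearr_eq_rearr
proof (rule measurable_rearr)
  show "(\<lambda>w. lcount (X w) t) \<in> borel_measurable M" for t
    unfolding lcount_prod_eq_suminf of_bool_def by measurable
qed (rule antimono_lcount)

lemma measurable_fam [measurable]:
  "(\<lambda>(U, B). desc_rearr (fam \<kappa> s U B)) \<in> measurable (SU \<Otimes>\<^sub>M SB m \<Gamma>) seqM"
  unfolding case_prod_beta
  by (rule measurable_desc_rearr_family) (unfold fam_def block_len_def prod.case, measurable)

lemma measurable_sticks [measurable]:
  "(\<lambda>(U, B). desc_rearr (\<lambda>(i, j). stick U i * B i j)) \<in> measurable (SU \<Otimes>\<^sub>M SB m \<Gamma>) seqM"
proof -
  have "(\<lambda>w. desc_rearr (\<lambda>(i, j). stick (fst w) i * snd w i j)) \<in> measurable (SU \<Otimes>\<^sub>M SB m \<Gamma>) seqM"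
    by (rule measurable_desc_rearr_family) (unfold stick_eq_rest prod.case, measurable)
  then show ?thesis by (simp add: case_prod_beta')
qed

lemma nn_integral_SU_SB:
  assumes "f \<in> borel_measurable (SU \<Otimes>\<^sub>M SB m \<Gamma>)"
  shows "(\<integral>\<^sup>+w. f w \<partial>(SU \<Otimes>\<^sub>M SB m \<Gamma>)) = (\<integral>\<^sup>+U. \<integral>\<^sup>+B. f (U, B) \<partial>SB m \<Gamma> \<partial>SU)"
proof -
  interpret B: prob_space "SB m \<Gamma>" by (rule prob_space_PiM) (rule prob_space_lawB)
  show ?thesis by (rule B.nn_integral_fst[OF assms, symmetric])
qed

text \<open>The two sides meet here: \<open>\<kappa> = 1 / n\<close> in \<open>val_eq_bval\<close>
  gives the point weight \<open>1 / n / m\<close>, the same as in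
  \<open>emeasure_lawC\<close>.\<close>

lemma lawC_eq_distr:
  assumes n: "1 \<le> n"
  shows "lawC m \<Gamma> n = distr (SU \<Otimes>\<^sub>M SB m \<Gamma>) seqM (\<lambda>(U, B). desc_rearr (fam (1 / real n) (real n) U B))"
proof (rule measure_eqI)
  fix S assume "S \<in> sets (lawC m \<Gamma> n)"
  then have S: "S \<in> sets seqM" by (simp add: lawC_def)
  let ?X = "\<lambda>(U, B). desc_rearr (fam (1 / real n) (real n) U B)"
  have [measurable]: "(indicator S :: _ \<Rightarrow> ennreal) \<in> borel_measurable seqM" using S by measurable
  have "emeasure (distr (SU \<Otimes>\<^sub>M SB m \<Gamma>) seqM ?X) S =
      (\<integral>\<^sup>+x. indicator S x \<partial>distr (SU \<Otimes>\<^sub>M SB m \<Gamma>) seqM ?X)"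
    using S by simp
  also have "\<dots> = (\<integral>\<^sup>+w. indicator S (?X w) \<partial>(SU \<Otimes>\<^sub>M SB m \<Gamma>))"
    by (rule nn_integral_distr) measurable
  also have "\<dots> = (\<integral>\<^sup>+U. \<integral>\<^sup>+B. indicator S (?X (U, B)) \<partial>SB m \<Gamma> \<partial>SU)"
    by (rule nn_integral_SU_SB) measurable
  also have "\<dots> = val (1 / real n) S (real n) (\<lambda>_. 0)"
    by (simp add: val_def desc_rearr_eq_rearr)
  also have "\<dots> = ennreal (bval (1 / real n / real m) (test S) n (\<lambda>_. 0))"
    by (rule val_eq_bval[OF S]) (use n in \<open>auto simp: antimono_def\<close>)
  also have "\<dots> = emeasure (lawC m \<Gamma> n) S"
    unfolding emeasure_lawC[OF S n] by (simp add: mult.commute)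
  finally show "emeasure (lawC m \<Gamma> n) S = emeasure (distr (SU \<Otimes>\<^sub>M SB m \<Gamma>) seqM ?X) S" ..
qed (simp add: lawC_def)

lemma AE_SB: "AE B in SB m \<Gamma>. \<forall>i. (\<forall>j. 0 \<le> B i j) \<and> (\<Sum>j. ennreal (B i j)) \<le> 1"
proof -
  have "AE b in lawB m \<Gamma>. (\<forall>j. 0 \<le> b j) \<and> (\<Sum>j. ennreal (b j)) \<le> 1"
    unfolding lawB_def
  proof (subst AE_distr_iff[OF measurable_pmf_seqM])
    show "{b \<in> space seqM. (\<forall>j. 0 \<le> b j) \<and> (\<Sum>j. ennreal (b j)) \<le> 1} \<in> sets seqM" by measurable
    show "AE b in measure_pmf (map_pmf (cycle_partition m) (pmf_of_set \<Gamma>)). (\<forall>j. 0 \<le> b j) \<and> (\<Sum>j. ennreal (b j)) \<le> 1"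
      using suminf_cycle_partition_le[OF perm] cycle_partition_nonneg[OF perm] nonempty
      by (auto simp: AE_measure_pmf_iff)
  qed
  then show ?thesis
    unfolding AE_all_countable
    by (intro allI AE_PiM_component[where P="\<lambda>b. (\<forall>j. 0 \<le> b j) \<and> (\<Sum>j. ennreal (b j)) \<le> 1"])
      (auto intro: prob_space_lawB)
qed

text \<open>Both families are driven by the same \<open>U\<close> and \<open>B\<close>, so their
  joint law is an admissible coupling.\<close>

lemma dist_rho_le:
  assumes n: "1 \<le> n" and [measurable]: "(\<lambda>z. \<rho> (fst z) (snd z)) \<in> borel_measurable (seqM \<Otimes>\<^sub>M seqM)"
  shows "dist_rho \<rho> (lawC m \<Gamma> n) (lawA m \<Gamma>) \<le>
    (\<integral>\<^sup>+U. \<integral>\<^sup>+B. \<rho> (desc_rearr (fam (1 / real n) (real n) U B)) (desc_rearr (\<lambda>(i, j). stick U i * B i j)) \<partial>SB m \<Gamma> \<partial>SU)"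
proof -
  let ?P = "SU \<Otimes>\<^sub>M SB m \<Gamma>"
  let ?X = "\<lambda>(U, B). desc_rearr (fam (1 / real n) (real n) U B)"
  let ?Y = "\<lambda>(U, B). desc_rearr (\<lambda>(i, j). stick U i * B i j)"
  interpret U: prob_space SU by (rule prob_space_PiM) (rule prob_space_U01)
  interpret B: prob_space "SB m \<Gamma>" by (rule prob_space_PiM) (rule prob_space_lawB)
  interpret P: pair_prob_space SU "SB m \<Gamma>" ..
  define M where "M = distr ?P (seqM \<Otimes>\<^sub>M seqM) (\<lambda>w. (?X w, ?Y w))"
  have XY [measurable]: "(\<lambda>w. (?X w, ?Y w)) \<in> measurable ?P (seqM \<Otimes>\<^sub>M seqM)" by measurable
  have "M \<in> couplings (lawC m \<Gamma> n) (lawA m \<Gamma>)"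
    unfolding couplings_def
  proof (intro CollectI conjI)
    show "prob_space M" unfolding M_def by (rule P.prob_space_distr) (rule XY)
    show "sets M = sets (seqM \<Otimes>\<^sub>M seqM)" by (simp add: M_def)
    show "distr M seqM fst = lawC m \<Gamma> n"
      unfolding M_def lawC_eq_distr[OF n] by (subst distr_distr) (auto simp: comp_def)
    show "distr M seqM snd = lawA m \<Gamma>"
      unfolding M_def lawA_def by (subst distr_distr) (auto simp: comp_def)
  qed
  then have "dist_rho \<rho> (lawC m \<Gamma> n) (lawA m \<Gamma>) \<le> (\<integral>\<^sup>+z. \<rho> (fst z) (snd z) \<partial>M)"
    unfolding dist_rho_def by (rule INF_lower)
  also have "\<dots> = (\<integral>\<^sup>+w. \<rho> (?X w) (?Y w) \<partial>?P)"
    unfolding M_def by (subst nn_integral_distr[OF XY]) simp_all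
  also have "\<dots> = (\<integral>\<^sup>+U. \<integral>\<^sup>+B. \<rho> (?X (U, B)) (?Y (U, B)) \<partial>SB m \<Gamma> \<partial>SU)"
  proof (rule nn_integral_SU_SB)
    show "(\<lambda>w. \<rho> (?X w) (?Y w)) \<in> borel_measurable ?P"
      using measurable_compose[OF XY assms(2)] by simp
  qed
  finally show ?thesis by simp
qed

text \<open>Scaled by \<open>n\<close>, the stick is a difference of two numbers that are both
  rounded down, which leaves a difference of fractional parts. The bounds feed the sorting
  estimates, which require bounded families.\<close>

lemma coupled_difference:
  assumes U: "\<And>i. U i \<in> {0..1}" and n: "1 \<le> n"
  shows "1 / real n * block_len (real n) U i - stick U i =
      (frac (real n * rest U (Suc i)) - frac (real n * rest U i)) / real n"
    and "0 \<le> stick U i" "stick U i \<le> 1" "0 \<le> 1 / real n * block_len (real n) U i" "1 / real n * block_len (real n) U i \<le> 1"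
proof -
  let ?a = "real n * rest U i" and ?b = "real n * rest U (Suc i)"
  have n0: "0 < real n" using n by simp
  have r: "0 \<le> rest U i" "rest U i \<le> 1" "0 \<le> rest U (Suc i)" "rest U (Suc i) \<le> 1"
    using rest_bounds[OF U] by auto
  have mono: "rest U (Suc i) \<le> rest U i"
    using r(1) U[of i] by (simp add: rest_def mult_left_le)
  show "1 / real n * block_len (real n) U i - stick U i = (frac ?b - frac ?a) / real n"
    using n0 by (simp add: block_len_def stick_eq_rest frac_def field_simps)
  show "0 \<le> stick U i" "stick U i \<le> 1" using r mono by (simp_all add: stick_eq_rest)
  have "?b \<le> ?a" using mono n0 by (intro mult_left_mono) auto
  then have "\<lfloor>?b\<rfloor> \<le> \<lfloor>?a\<rfloor>" by (rule floor_mono)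
  then show "0 \<le> 1 / real n * block_len (real n) U i" using n0 by (simp add: block_len_def)
  have "?a \<le> real n" using r n0 by (simp add: mult_left_le)
  then have "\<lfloor>?a\<rfloor> \<le> int n" by linarith
  moreover have "0 \<le> \<lfloor>?b\<rfloor>" using r n0 by simp
  ultimately have "block_len (real n) U i \<le> real n" unfolding block_len_def by linarith
  then show "1 / real n * block_len (real n) U i \<le> 1" using n0 by (simp add: divide_le_eq_1)
qed

section \<open>Pathwise comparison of the coupled families\<close>

context
  fixes U :: "nat \<Rightarrow> real" and B :: "nat \<Rightarrow> nat \<Rightarrow> real" and n :: nat
  assumes U: "\<And>i. U i \<in> {0..1}" and n: "1 \<le> n"
    and B: "\<And>i j. 0 \<le> B i j" "\<And>i. (\<Sum>j. ennreal (B i j)) \<le> 1"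
begin

lemma B_le_1: "B i j \<le> 1"
proof -
  have "ennreal (B i j) \<le> (\<Sum>j. ennreal (B i j))"
    using sum_le_suminf[of "\<lambda>j. ennreal (B i j)" "{j}"] by simp
  then have "ennreal (B i j) \<le> 1" using B(2)[of i] by (rule order.trans)
  then show ?thesis by simp
qed

lemma coupled_bounds:
  "0 \<le> fam (1 / real n) (real n) U B p" "fam (1 / real n) (real n) U B p \<le> 1"
  "0 \<le> (\<lambda>(i, j). stick U i * B i j) p" "(\<lambda>(i, j). stick U i * B i j) p \<le> 1"
proof -
  obtain i j where p: "p = (i, j)" by force
  note d = coupled_difference(2-5)[where U=U, OF U n, of i]
  show "0 \<le> fam (1 / real n) (real n) U B p" "fam (1 / real n) (real n) U B p \<le> 1"
    unfolding fam_def p prod.case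
    by (rule mult_nonneg_nonneg[OF d(3) B(1)], rule mult_le_one[OF d(4) B(1) B_le_1])
  show "0 \<le> (\<lambda>(i, j). stick U i * B i j) p" "(\<lambda>(i, j). stick U i * B i j) p \<le> 1"
    unfolding p prod.case
    by (rule mult_nonneg_nonneg[OF d(1) B(1)], rule mult_le_one[OF d(2) B(1) B_le_1])
qed

lemma coupled_abs_difference:
  "\<bar>fam (1 / real n) (real n) U B (i, j) - stick U i * B i j\<bar> =
    \<bar>frac (real n * rest U i) - frac (real n * rest U (Suc i))\<bar> / real n * B i j"
proof -
  have "fam (1 / real n) (real n) U B (i, j) - stick U i * B i j =
      (1 / real n * block_len (real n) U i - stick U i) * B i j"
    by (simp add: fam_def algebra_simps)
  then show ?thesis
    unfolding coupled_difference(1)[where U=U, OF U n] using B(1) by (simp add: abs_mult abs_minus_commute)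
qed

lemma coupled_rho_inf:
  "rho_inf (desc_rearr (fam (1 / real n) (real n) U B)) (desc_rearr (\<lambda>(i, j). stick U i * B i j)) \<le> ennreal (1 / real n)"
  unfolding rho_inf_def
proof (intro SUP_least ennreal_leI)
  fix k
  show "\<bar>desc_rearr (fam (1 / real n) (real n) U B) k - desc_rearr (\<lambda>(i, j). stick U i * B i j) k\<bar> \<le> 1 / real n"
  proof (rule desc_rearr_dist_sup[where b=1])
    fix p :: "nat \<times> nat"
    obtain i j where p: "p = (i, j)" by force
    let ?d = "\<bar>frac (real n * rest U i) - frac (real n * rest U (Suc i))\<bar>"
    have "?d \<le> 1"
      using frac_lt_1[of "real n * rest U i"] frac_lt_1[of "real n * rest U (Suc i)"]
        frac_ge_0[of "real n * rest U i"] frac_ge_0[of "real n * rest U (Suc i)"] by linarith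
    then have "?d / real n * B i j \<le> 1 / real n * 1"
      using B(1) B_le_1 by (intro mult_mono divide_right_mono) auto
    then show "\<bar>fam (1 / real n) (real n) U B p - (case p of (i, j) \<Rightarrow> stick U i * B i j)\<bar> \<le> 1 / real n"
      using coupled_abs_difference[of i j] by (simp add: p)
  qed (use coupled_bounds in auto)
qed

lemma coupled_rho_1:
  "rho_1 (desc_rearr (fam (1 / real n) (real n) U B)) (desc_rearr (\<lambda>(i, j). stick U i * B i j)) \<le>
    (\<Sum>i. ennreal \<bar>frac (real n * rest U i) - frac (real n * rest U (Suc i))\<bar>) * ennreal (1 / real n)"
proof -
  let ?d = "\<lambda>i. \<bar>frac (real n * rest U i) - frac (real n * rest U (Suc i))\<bar>"
  have "rho_1 (desc_rearr (fam (1 / real n) (real n) U B)) (desc_rearr (\<lambda>(i, j). stick U i * B i j)) \<le>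
      (\<integral>\<^sup>+p. ennreal \<bar>fam (1 / real n) (real n) U B p - (case p of (i, j) \<Rightarrow> stick U i * B i j)\<bar> \<partial>count_space UNIV)"
    by (rule desc_rearr_dist_sum[where b=1]) (rule coupled_bounds)+
  also have "\<dots> = (\<Sum>i. \<Sum>j. ennreal (?d i / real n * B i j))"
    by (simp add: nn_integral_fst_count_space[symmetric] nn_integral_count_space_nat coupled_abs_difference)
  also have "\<dots> = (\<Sum>i. ennreal (?d i) * ennreal (1 / real n) * (\<Sum>j. ennreal (B i j)))"
    using B(1) by (simp add: ennreal_mult[symmetric] ennreal_suminf_cmult[symmetric])
  also have "\<dots> \<le> (\<Sum>i. ennreal (?d i) * ennreal (1 / real n) * 1)"
    by (intro suminf_le mult_left_mono B(2)) auto
  also have "\<dots> = (\<Sum>i. ennreal (?d i)) * ennreal (1 / real n)"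
    by (simp add: ennreal_suminf_multc)
  finally show ?thesis .
qed

end

section \<open>Expected distances and the harmonic number\<close>

lemma dist_rho_inf_le:
  assumes n: "1 \<le> n"
  shows "dist_rho rho_inf (lawC m \<Gamma> n) (lawA m \<Gamma>) \<le> ennreal (1 / real n)"
proof -
  interpret U: prob_space SU by (rule prob_space_PiM) (rule prob_space_U01)
  interpret B: prob_space "SB m \<Gamma>" by (rule prob_space_PiM) (rule prob_space_lawB)
  let ?\<rho> = "\<lambda>U B. rho_inf (desc_rearr (fam (1 / real n) (real n) U B)) (desc_rearr (\<lambda>(i, j). stick U i * B i j))"
  have [measurable]: "(\<lambda>z. rho_inf (fst z) (snd z)) \<in> borel_measurable (seqM \<Otimes>\<^sub>M seqM)"
    unfolding rho_inf_def by measurable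
  have "dist_rho rho_inf (lawC m \<Gamma> n) (lawA m \<Gamma>) \<le> (\<integral>\<^sup>+U. \<integral>\<^sup>+B. ?\<rho> U B \<partial>SB m \<Gamma> \<partial>SU)"
    by (rule dist_rho_le[OF n]) measurable
  also have "\<dots> \<le> (\<integral>\<^sup>+U. \<integral>\<^sup>+B. ennreal (1 / real n) \<partial>SB m \<Gamma> \<partial>SU)"
  proof (rule nn_integral_mono_AE, rule eventually_mono[OF AE_SU])
    fix U :: "nat \<Rightarrow> real" assume U: "\<forall>i. U i \<in> {0..1}"
    show "(\<integral>\<^sup>+B. ?\<rho> U B \<partial>SB m \<Gamma>) \<le> (\<integral>\<^sup>+B. ennreal (1 / real n) \<partial>SB m \<Gamma>)"
      by (intro nn_integral_mono_AE eventually_mono[OF AE_SB] coupled_rho_inf) (use U n in auto)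
  qed
  also have "\<dots> = ennreal (1 / real n)"
    by (simp add: U.emeasure_space_1 B.emeasure_space_1)
  finally show ?thesis .
qed

lemma dist_rho_1_le:
  assumes n: "1 \<le> n"
  shows "dist_rho rho_1 (lawC m \<Gamma> n) (lawA m \<Gamma>) \<le> ennreal (2 * harm n / real n)"
proof -
  interpret U: prob_space SU by (rule prob_space_PiM) (rule prob_space_U01)
  interpret B: prob_space "SB m \<Gamma>" by (rule prob_space_PiM) (rule prob_space_lawB)
  let ?\<rho> = "\<lambda>U B. rho_1 (desc_rearr (fam (1 / real n) (real n) U B)) (desc_rearr (\<lambda>(i, j). stick U i * B i j))"
  let ?d = "\<lambda>U i. ennreal \<bar>frac (real n * rest U i) - frac (real n * rest U (Suc i))\<bar>"
  have [measurable]: "(\<lambda>z. rho_1 (fst z) (snd z)) \<in> borel_measurable (seqM \<Otimes>\<^sub>M seqM)"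
    unfolding rho_1_def by measurable
  have [measurable]: "(\<lambda>U. ?d U i) \<in> borel_measurable SU" for i
    unfolding frac_def by measurable
  have "dist_rho rho_1 (lawC m \<Gamma> n) (lawA m \<Gamma>) \<le> (\<integral>\<^sup>+U. \<integral>\<^sup>+B. ?\<rho> U B \<partial>SB m \<Gamma> \<partial>SU)"
    by (rule dist_rho_le[OF n]) measurable
  also have "\<dots> \<le> (\<integral>\<^sup>+U. \<integral>\<^sup>+B. (\<Sum>i. ?d U i) * ennreal (1 / real n) \<partial>SB m \<Gamma> \<partial>SU)"
  proof (rule nn_integral_mono_AE, rule eventually_mono[OF AE_SU])
    fix U :: "nat \<Rightarrow> real" assume U: "\<forall>i. U i \<in> {0..1}"
    show "(\<integral>\<^sup>+B. ?\<rho> U B \<partial>SB m \<Gamma>) \<le> (\<integral>\<^sup>+B. (\<Sum>i. ?d U i) * ennreal (1 / real n) \<partial>SB m \<Gamma>)"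
      by (intro nn_integral_mono_AE eventually_mono[OF AE_SB] coupled_rho_1) (use U n in auto)
  qed
  also have "\<dots> = (\<integral>\<^sup>+U. (\<Sum>i. ?d U i) * ennreal (1 / real n) \<partial>SU)"
    by (simp add: B.emeasure_space_1)
  also have "\<dots> = (\<integral>\<^sup>+U. (\<Sum>i. ?d U i) \<partial>SU) * ennreal (1 / real n)"
    by (rule nn_integral_multc) measurable
  also have "(\<integral>\<^sup>+U. (\<Sum>i. ?d U i) \<partial>SU) \<le> ennreal (2 * harm n)"
  proof -
    have "(\<integral>\<^sup>+U. (\<Sum>i. ?d U i) \<partial>SU) = (\<Sum>i. \<integral>\<^sup>+U. ?d U i \<partial>SU)"
      by (rule nn_integral_suminf) measurable
    also have "\<dots> \<le> ennreal (2 * harm n)"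
    proof (rule suminf_le_const)
      fix k
      have "(\<Sum>i<k. \<integral>\<^sup>+U. ?d U i \<partial>SU) = (\<integral>\<^sup>+U. (\<Sum>i<k. ?d U i) \<partial>SU)"
        by (rule nn_integral_sum[symmetric]) measurable
      \<comment> \<open>The start \<open>n\<close> is an integer, so the initial potential
        \<open>frac n\<close> vanishes and the bound is uniform in \<open>k\<close>.\<close>
      also have "\<dots> \<le> ennreal (frac (real n) + 2 * harm (nat \<lfloor>real n\<rfloor>))"
        by (rule expected_frac_variation) simp
      finally show "(\<Sum>i<k. \<integral>\<^sup>+U. ?d U i \<partial>SU) \<le> ennreal (2 * harm n)" by (simp add: frac_def)
    qed simp
    finally show ?thesis .
  qed
  also have "ennreal (2 * harm n) * ennreal (1 / real n) = ennreal (2 * harm n / real n)"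
    by (subst ennreal_mult[symmetric]) (simp_all add: harm_nonneg)
  finally show ?thesis by (simp add: mult_right_mono)
qed

end

text \<open>The bound \<open>euler_mascheroni_lower\<close> involves \<open>ln (n + 1)\<close>;
  replacing it by \<open>ln n\<close> costs \<open>ln (1 + 1 / n) \<le> 1 / n\<close>.\<close>

lemma harm_le_ln_euler:
  assumes "1 \<le> n"
  shows "harm n \<le> ln (real n) + euler_mascheroni + 1 / real n"
proof -
  obtain k where k: "n = Suc k" using assms by (cases n) auto
  have "real (k + 2) = real n * (1 + 1 / real n)" unfolding k by (simp add: field_simps)
  then have "ln (real (k + 2)) = ln (real n) + ln (1 + 1 / real n)"
    unfolding k by (simp only:) (rule ln_mult_pos, simp, rule add_pos_nonneg, simp_all)
  also have "ln (1 + 1 / real n) \<le> 1 / real n" by (rule ln_add_one_self_le_self) simp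
  moreover have "0 \<le> 1 / real (2 * (k + 2))" by simp
  ultimately show ?thesis using euler_mascheroni_lower[of k] unfolding k by linarith
qed

lemma perm_subgroup_of_subgroup:
  assumes "m \<ge> 1" and sub: "subgroup \<Gamma> (sym_group m)"
  shows "perm_subgroup m \<Gamma>"
proof
  have perm: "\<gamma> permutes {1..m}" if "\<gamma> \<in> \<Gamma>" for \<gamma>
    using subgroup.mem_carrier[OF sub that] by (simp add: sym_group_carrier)
  then show "\<gamma> permutes {1..m}" if "\<gamma> \<in> \<Gamma>" for \<gamma> using that .
  show "\<gamma> \<circ> \<delta> \<in> \<Gamma>" if "\<gamma> \<in> \<Gamma>" "\<delta> \<in> \<Gamma>" for \<gamma> \<delta>
    using subgroup.m_closed[OF sub that] by (simp add: sym_group_mult)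
  show "inv' \<gamma> \<in> \<Gamma>" if "\<gamma> \<in> \<Gamma>" for \<gamma>
    using subgroup.m_inv_closed[OF sub that] subgroup.mem_carrier[OF sub that] by simp
  show "\<Gamma> \<noteq> {}" using subgroup.one_closed[OF sub] by auto
qed (use assms in auto)

theorem mainTheorem6:
  fixes m :: nat and \<Gamma> :: "(nat \<Rightarrow> nat) set"
  assumes "m \<ge> 1"
    and "subgroup \<Gamma> (sym_group m)"
  shows "(\<forall>n::nat. n \<ge> 1 \<longrightarrow>
            dist_rho rho_inf (lawC m \<Gamma> n) (lawA m \<Gamma>) \<le> ennreal (1 / real n))
       \<and> (\<exists>K::real. \<forall>n::nat. n \<ge> 1 \<longrightarrow>
            dist_rho rho_1 (lawC m \<Gamma> n) (lawA m \<Gamma>)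
              \<le> ennreal (3 * (ln (real n) + euler_mascheroni) / real n + K / (real n)^2))"
proof -
  interpret perm_subgroup m \<Gamma> using assms by (rule perm_subgroup_of_subgroup)
  have "dist_rho rho_1 (lawC m \<Gamma> n) (lawA m \<Gamma>)
      \<le> ennreal (3 * (ln (real n) + euler_mascheroni) / real n + 2 / (real n)^2)" if n: "n \<ge> 1" for n :: nat
  proof -
    have "0 \<le> ln (real n)" using n by simp
    then have "0 \<le> ln (real n) + (euler_mascheroni :: real)" using euler_mascheroni_pos by linarith
    \<comment> \<open>Nonnegativity of \<open>ln n + euler_mascheroni\<close> allows 2 to be raised
      to 3. The doubled error \<open>1 / n\<close> is the source of the constant 2 in the error
      term.\<close>
    then have "2 * harm n \<le> 3 * (ln (real n) + euler_mascheroni) + 2 / real n"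
      using harm_le_ln_euler[OF n] by simp
    then have "2 * harm n / real n \<le> (3 * (ln (real n) + euler_mascheroni) + 2 / real n) / real n"
      by (rule divide_right_mono) simp
    also have "\<dots> = 3 * (ln (real n) + euler_mascheroni) / real n + 2 / (real n)^2"
      by (simp add: add_divide_distrib power2_eq_square)
    finally show ?thesis using dist_rho_1_le[OF n] by (meson ennreal_leI order.trans)
  qed
  then show ?thesis using dist_rho_inf_le by blast
qed

end
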